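(* Let $N\geq1$ be an integer, $m>1$, $0<p<1$, $\sigma=\frac{2(1-p)}{m-1}$, and assume $m+p=2$. Let $$\alpha^*=\frac{4\sqrt{m}}{m-1}.$$ Then, for any fixed $\alpha\in[\alpha^*,\infty)$, there exists a unique good profile with interface $f(\xi)$ with $f(0)=1$ and having the interface behavior $f(\xi)\sim C(\xi_0-\xi)_{+}^{1/(m-1)}$ as $\xi\to\xi_0$, for some constant $C>0$. There is no good profile with interface for $\alpha\in(0,\alpha^* )$.
   Context: The profiles arise from radially symmetric self-similar solutions $u(x,t)=e^{\alpha t}f(\xi)$, $\xi=|x|e^{-\beta t}$, of $u_t=\Delta u^m+|x|^{\sigma}u^p$ in $\mathbb{R}^N$. The self-similar exponents satisfy $\alpha>0$ and $\beta=\frac{m-1}{2}\alpha$, and the profile $f\geq0$ solves $$(f^m)''(\xi)+\frac{N-1}{\xi}(f^m)'(\xi)-\alpha f(\xi)+\beta\xi f'(\xi)+\xi^{\sigma}f(\xi)^p=0.\qquad(\ast)$$ For given $\alpha>0$, a solution $f$ of $(\ast)$ is called a good profile with interface if: (i) $f(0)=A>0$ and $f'(0)=0$; (ii) there exists $\xi_0\in(0,\infty)$ such that $f(\xi_0)=0$, $f(\xi)>0$ for all $\xi\in(0,\xi_0)$, and $(f^m)'(\xi_0)=0$. In the claim $\xi_0$ denotes this point. The notation $g\sim h$ means $g/h\to1$ as $\xi\to\xi_0$, $\xi<\xi_0$. *)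

theory Defs
  imports "HOL-Analysis.Analysis" "HOL-Library.Landau_Symbols"
begin

text \<open>
  The profile equation. The exponents are real, so \<open>f\<^sup>m\<close> and \<open>f\<^sup>p\<close> are rendered by \<open>powr\<close>,
  which agrees with the usual power for \<open>f > 0\<close> and gives \<open>0 powr m = 0\<close>.
  Existence of all derivatives occurring in the equation is required explicitly,
  since \<open>deriv\<close> is unspecified at points of non-differentiability.
\<close>

definition solves_profile_eq ::
  "nat \<Rightarrow> real \<Rightarrow> real \<Rightarrow> real \<Rightarrow> real \<Rightarrow> real \<Rightarrow> (real \<Rightarrow> real) \<Rightarrow> real set \<Rightarrow> bool" where
  "solves_profile_eq N m p \<sigma> \<alpha> \<beta> f S \<longleftrightarrow>
     (\<forall>\<xi>\<in>S.
        f differentiable at \<xi> \<and>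
        (\<lambda>x. f x powr m) differentiable at \<xi> \<and>
        deriv (\<lambda>x. f x powr m) differentiable at \<xi> \<and>
        deriv (deriv (\<lambda>x. f x powr m)) \<xi>
          + (real N - 1) / \<xi> * deriv (\<lambda>x. f x powr m) \<xi>
          - \<alpha> * f \<xi> + \<beta> * \<xi> * deriv f \<xi> + \<xi> powr \<sigma> * f \<xi> powr p = 0)"

text \<open>
  A profile with interface at \<open>\<xi>\<^sub>0\<close> is a function on \<open>[0, \<xi>\<^sub>0]\<close>; values of \<open>f\<close> outside this
  interval are irrelevant. Accordingly the derivatives at the two endpoints are one-sided.
\<close>

definition good_profile_with_interface ::
  "nat \<Rightarrow> real \<Rightarrow> real \<Rightarrow> real \<Rightarrow> real \<Rightarrow> (real \<Rightarrow> real) \<Rightarrow> real \<Rightarrow> bool" where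
  "good_profile_with_interface N m p \<sigma> \<alpha> f \<xi>\<^sub>0 \<longleftrightarrow>
     0 < \<xi>\<^sub>0 \<and>
     solves_profile_eq N m p \<sigma> \<alpha> ((m - 1) / 2 * \<alpha>) f {0<..<\<xi>\<^sub>0} \<and>
     f 0 > 0 \<and> (f has_real_derivative 0) (at_right 0) \<and>
     f \<xi>\<^sub>0 = 0 \<and> (\<forall>\<xi>\<in>{0<..<\<xi>\<^sub>0}. f \<xi> > 0) \<and>
     ((\<lambda>x. f x powr m) has_real_derivative 0) (at_left \<xi>\<^sub>0)"

definition interface_behavior :: "real \<Rightarrow> (real \<Rightarrow> real) \<Rightarrow> real \<Rightarrow> bool" where
  "interface_behavior m f \<xi>\<^sub>0 \<longleftrightarrow>
     (\<exists>C>0. f \<sim>[at_left \<xi>\<^sub>0] (\<lambda>\<xi>. C * max 0 (\<xi>\<^sub>0 - \<xi>) powr (1 / (m - 1))))"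

definition alpha_star :: "real \<Rightarrow> real" where
  "alpha_star m = 4 * sqrt m / (m - 1)"

end

theory Submission
  imports Defs
begin

text \<open>
  For \<open>m + p = 2\<close> one has \<open>\<sigma> = 2\<close>, and in terms of the pressure \<open>g = f\<^sup>m\<^sup>-\<^sup>1\<close> the profile equation
  becomes quadratic, with all terms homogeneous under \<open>g(x) \<mapsto> \<lambda>\<^sup>-\<^sup>2 g(\<lambda>x)\<close>. Put \<open>a = 1/(m-1) > 1\<close>,
  \<open>s = g'/x\<close> and \<open>Q(s) = a(a+1)s\<^sup>2 + (\<alpha>/2)s + 1\<close>. The equation is then the first order system
  \<open>g' = x s\<close>, \<open>x s' = \<alpha>/(a+1) - N s - x\<^sup>2 Q(s)/((a+1)g)\<close> (\<open>flow\<close>), and a profile with \<open>f(0) = 1\<close>,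
  \<open>f'(0) = 0\<close> is a solution starting from \<open>g(0) = 1\<close>, \<open>s(0) = \<alpha>/((a+1)N)\<close> (\<open>central\<close>).

  The discriminant of \<open>Q\<close> is nonnegative exactly when \<open>\<alpha> \<ge> \<alpha>\<^sup>*\<close>. As \<open>g\<close> tends to \<open>0\<close>, the term with
  \<open>1/g\<close> dominates and drives \<open>s\<close> to \<open>-\<infinity>\<close> unless \<open>Q(s)\<close> comes close to \<open>0\<close>
  (\<open>interface_slope_critical\<close>). On the other hand, the interface condition \<open>(f\<^sup>m)'(\<xi>\<^sub>0) = 0\<close>
  bounds \<open>s\<close> from below (\<open>profile_interface\<close>). Hence no profile exists for \<open>\<alpha> < \<alpha>\<^sup>*\<close>.

  For \<open>\<alpha> \<ge> \<alpha>\<^sup>*\<close> let \<open>r < 0\<close> be the larger root of \<open>Q\<close>. The line \<open>s = r\<close> cannot be crossed downwards, so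
  \<open>r < s \<le> s(0)\<close> along the central solution, and a Lyapunov function that decreases at a definite
  rate shows that the solution cannot live forever (\<open>central_life_bounded\<close>). It therefore stops
  at a finite \<open>X\<close>, where \<open>g\<close> must tend to \<open>0\<close> (\<open>maximal_central\<close>), and then \<open>s\<close> tends to \<open>r\<close>
  (\<open>central_slope_limit\<close>). So \<open>g(x) \<sim> -r X (X - x)\<close>, and \<open>f = g\<^sup>a\<close> has the claimed interface.

  Local existence at the singular point \<open>x = 0\<close> is a contraction argument
  (\<open>singular_ivp_exists\<close>). Uniqueness is an energy estimate in which the singular term \<open>N/x\<close> is
  dissipative (\<open>central_unique\<close>). It applies to every profile with \<open>f(0) = 1\<close>, because a flux balance at the centre
  forces \<open>s\<close> to have the right limit there (\<open>profile_is_central\<close>).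
\<close>

section \<open>Barriers and monotonicity on the real line\<close>

lemma first_crossing:
  fixes h :: "real \<Rightarrow> real"
  assumes cont: "continuous_on {a..b} h" and ha: "h a > c" and x: "x \<in> {a..b}" "h x \<le> c"
  obtains y where "a < y" "y \<le> x" "h y = c" "\<And>t. a \<le> t \<Longrightarrow> t < y \<Longrightarrow> h t > c"
proof -
  let ?S = "{t \<in> {a..x}. h t \<le> c}"
  have cx: "continuous_on {a..x} h" using cont x(1) by (auto intro: continuous_on_subset)
  have "closed ?S"
    by (rule continuous_on_closed_Collect_le[OF cx continuous_on_const]) simp
  then have "compact ?S"
    by (metis (no_types, lifting) bounded_closed_interval bounded_subset compact_eq_bounded_closed mem_Collect_eq subsetI)
  moreover have "?S \<noteq> {}" using x by auto
  ultimately obtain y where y: "y \<in> ?S" and ymin: "\<And>t. t \<in> ?S \<Longrightarrow> y \<le> t"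
    using compact_attains_inf[of ?S] by blast
  have before: "h t > c" if "a \<le> t" "t < y" for t
    using ymin[of t] that y by (force simp: not_le)
  have "a < y" using y ha by (cases "a = y") auto
  have "h y = c"
  proof (rule ccontr)
    assume "h y \<noteq> c"
    then have "h y < c" using y by auto
    moreover have "continuous_on {a..y} h" using cx y by (auto intro: continuous_on_subset)
    ultimately obtain t where "a \<le> t" "t \<le> y" "h t = c"
      using IVT2'[of h y c a] ha \<open>a < y\<close> by auto
    then show False using before[of t] \<open>h y < c\<close> by (cases "t = y") auto
  qed
  then show ?thesis using that before \<open>a < y\<close> y by auto
qed

lemma barrier:
  fixes h :: "real \<Rightarrow> real"
  assumes cont: "continuous_on {a..b} h" and ha: "h a > c" and x: "x \<in> {a..b}"
    and up: "\<And>y. a < y \<Longrightarrow> y \<le> b \<Longrightarrow> h y = c \<Longrightarrow> \<exists>D>0. (h has_real_derivative D) (at y)"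
  shows "h x > c"
proof (rule ccontr)
  assume "\<not> h x > c"
  then obtain y where y: "a < y" "y \<le> x" "h y = c" "\<And>t. a \<le> t \<Longrightarrow> t < y \<Longrightarrow> h t > c"
    using first_crossing[OF cont ha x] by (auto simp: not_less)
  then obtain D where "D > 0" "(h has_real_derivative D) (at y)" using up[of y] x y by auto
  from DERIV_pos_inc_left[OF this(2,1)] obtain d where d: "d > 0" "\<And>k. 0 < k \<Longrightarrow> k < d \<Longrightarrow> h (y - k) < h y"
    by blast
  define k where "k = min (d/2) (y - a)"
  have "h (y - k) < h y" using d y(1) by (intro d(2)) (auto simp: k_def)
  moreover have "h (y - k) > c" using y d by (intro y(4)) (auto simp: k_def)
  ultimately show False using y(3) by simp
qed

lemma continuous_abs_bounded:
  fixes h :: "real \<Rightarrow> real"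
  assumes "continuous_on {a..b} h"
  obtains B where "B \<ge> 0" "\<And>t. t \<in> {a..b} \<Longrightarrow> \<bar>h t\<bar> \<le> B"
proof -
  have "bounded (h ` {a..b})"
    using assms by (intro compact_imp_bounded compact_continuous_image) auto
  then obtain B where "\<forall>y\<in>h ` {a..b}. \<bar>y\<bar> \<le> B" unfolding bounded_iff by auto
  then show ?thesis using that[of "max B 0"] by (fastforce simp: le_max_iff_disj)
qed

lemma nonincreasing_between:
  fixes f :: "real \<Rightarrow> real"
  assumes "a < x" "x \<le> y" "y < b"
    and "\<And>t. a < t \<Longrightarrow> t < b \<Longrightarrow> \<exists>D\<le>0. (f has_real_derivative D) (at t)"
  shows "f y \<le> f x"
proof (rule DERIV_nonpos_imp_nonincreasing[OF assms(2)])
  fix t assume "x \<le> t" "t \<le> y"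
  then have "a < t" "t < b" using assms by auto
  then show "\<exists>D. (f has_real_derivative D) (at t) \<and> D \<le> 0" using assms(4)[of t] by blast
qed

text \<open>
  Comparison from a singular left end point: there only the limit of the function is known.
\<close>

lemma nonincreasing_from_limit:
  fixes f :: "real \<Rightarrow> real"
  assumes lim: "(f \<longlongrightarrow> l) (at_right a)" and x: "a < x" "x < b"
    and D: "\<And>t. a < t \<Longrightarrow> t < b \<Longrightarrow> \<exists>D\<le>0. (f has_real_derivative D) (at t)"
  shows "f x \<le> l"
proof (rule tendsto_lowerbound[OF lim])
  show "\<forall>\<^sub>F t in at_right a. f x \<le> f t"
    using eventually_at_right_real[OF x(1)]
    by eventually_elim (use x D in \<open>auto intro!: nonincreasing_between[of a _ _ b f]\<close>)
qed simp

section \<open>A singular initial value problem\<close>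

text \<open>
  Picard iteration in the weighted norm \<open>sup |u(t)| exp(-L t)\<close>. The operator acts on plain functions,
  and the contraction hypothesis is read off from pointwise bounds, so that no space of continuous
  functions on \<open>[0, R]\<close> has to be set up.
\<close>

lemma weighted_picard:
  fixes T :: "(real \<Rightarrow> real) \<Rightarrow> real \<Rightarrow> real"
  assumes L: "L \<ge> 0"
    and cont: "\<And>u. continuous_on {0..R} u \<Longrightarrow> continuous_on {0..R} (T u)"
    and contr: "\<And>u v d x. \<lbrakk>continuous_on {0..R} u; continuous_on {0..R} v;
        \<And>t. t \<in> {0..R} \<Longrightarrow> \<bar>u t - v t\<bar> \<le> d * exp (L * t); x \<in> {0..R}\<rbrakk>
        \<Longrightarrow> \<bar>T u x - T v x\<bar> \<le> d / 2 * exp (L * x)"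
  obtains u where "continuous_on {0..R} u" "\<And>x. x \<in> {0..R} \<Longrightarrow> T u x = u x"
proof -
  define U where "U n = (T ^^ n) (\<lambda>_. 0)" for n
  have U0: "U 0 x = 0" for x by (simp add: U_def)
  have US: "U (Suc n) = T (U n)" for n by (simp add: U_def)
  have Ucont: "continuous_on {0..R} (U n)" for n
    by (induction n) (auto simp: US cont U0 [abs_def] intro: continuous_on_cong[THEN iffD1, OF refl _ continuous_on_const])
  obtain d where d: "\<And>t. t \<in> {0..R} \<Longrightarrow> \<bar>U 1 t\<bar> \<le> d"
    using continuous_abs_bounded[OF Ucont[of 1]] by metis
  have step: "t \<in> {0..R} \<Longrightarrow> \<bar>U (Suc n) t - U n t\<bar> \<le> d / 2 ^ n * exp (L * t)" for n t
  proof (induction n arbitrary: t)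
    case 0
    have "d \<ge> 0" using d[OF 0] by linarith
    moreover have "1 \<le> exp (L * t)" using L 0 by simp
    ultimately have "d * 1 \<le> d * exp (L * t)" by (intro mult_left_mono)
    then show ?case using d[OF 0] by (simp add: U0)
  next
    case (Suc n)
    have "\<bar>T (U (Suc n)) t - T (U n) t\<bar> \<le> (d / 2 ^ n) / 2 * exp (L * t)"
      by (rule contr[OF Ucont Ucont Suc.IH Suc.prems])
    then show ?case by (simp add: US mult.commute)
  qed
  have step': "norm (U (Suc n) t - U n t) \<le> d * exp (L * R) * (1/2) ^ n" if "t \<in> {0..R}" for n t
  proof -
    have "d \<ge> 0" using d[OF that] by linarith
    then have "d / 2 ^ n * exp (L * t) \<le> d / 2 ^ n * exp (L * R)"
      using that L by (intro mult_left_mono) (auto intro: mult_left_mono)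
    then show ?thesis using step[OF that, of n] by (simp add: power_divide)
  qed
  define u where "u x = (\<Sum>i. U (Suc i) x - U i x)" for x
  have "uniform_limit {0..R} (\<lambda>n x. \<Sum>i<n. U (Suc i) x - U i x) u sequentially"
    unfolding u_def
    by (rule Weierstrass_m_test[OF step']) (auto intro!: summable_mult summable_geometric)
  moreover have "(\<Sum>i<n. U (Suc i) x - U i x) = U n x" for n x
    using sum_lessThan_telescope[of "\<lambda>i. U i x" n] by (simp add: U0)
  ultimately have ul: "uniform_limit {0..R} U u sequentially" by simp
  have ucont: "continuous_on {0..R} u"
    by (rule uniform_limit_theorem[OF _ ul]) (auto simp: Ucont)
  have "T u x = u x" if x: "x \<in> {0..R}" for x
  proof (rule LIMSEQ_unique)
    show "(\<lambda>n. U (Suc n) x) \<longlonglongrightarrow> u x"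
      using tendsto_uniform_limitI[OF ul x] by (rule LIMSEQ_Suc)
    show "(\<lambda>n. U (Suc n) x) \<longlonglongrightarrow> T u x"
    proof (rule tendstoI)
      fix e :: real assume e: "e > 0"
      define e' where "e' = e / exp (L * x)"
      have "e' > 0" using e by (simp add: e'_def)
      from uniform_limitD[OF ul this] show "\<forall>\<^sub>F n in sequentially. dist (U (Suc n) x) (T u x) < e"
      proof eventually_elim
        case (elim n)
        have "\<bar>U n t - u t\<bar> \<le> e' * exp (L * t)" if "t \<in> {0..R}" for t
        proof -
          have "e' * 1 \<le> e' * exp (L * t)" using L that \<open>e' > 0\<close> by (intro mult_left_mono) auto
          then show ?thesis using elim that by (force simp: dist_real_def)
        qed
        from contr[OF Ucont ucont this x] have "\<bar>T (U n) x - T u x\<bar> \<le> e / 2"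
          by (simp add: e'_def)
        then show ?case using e by (simp add: US dist_real_def)
      qed
    qed
  qed
  with ucont show ?thesis using that by blast
qed

lemma integral_exp_le:
  fixes L :: real assumes "L > 0" "x \<ge> 0"
  shows "integral {0..x} (\<lambda>t. exp (L * t)) \<le> exp (L * x) / L"
proof -
  have "((\<lambda>t. exp (L * t)) has_integral (exp (L * x) / L - exp (L * 0) / L)) {0..x}"
    using assms by (intro fundamental_theorem_of_calculus)
      (auto intro!: derivative_eq_intros simp: has_real_derivative_iff_has_vector_derivative[symmetric])
  then show ?thesis using assms by (simp add: integral_unique divide_simps)
qed

text \<open>
  Multiplying the equation for \<open>u\<close> by \<open>x\<^sup>N\<close> turns it into
  \<open>(x\<^sup>N (u - s\<^sub>0))' = - x\<^sup>N\<^sup>+\<^sup>1 \<phi>(u, g)\<close>. Integration gives a fixed point equation for \<open>u\<close> alone, with \<open>g\<close>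
  recovered from \<open>u\<close>. The kernel is bounded by \<open>x\<^sup>-\<^sup>N t\<^sup>N\<^sup>+\<^sup>1 \<le> x\<close>, so the singularity at \<open>0\<close> is harmless, and a
  large weight \<open>L\<close> makes the operator a contraction on all of \<open>[0, R]\<close>.
\<close>

lemma singular_ivp_exists:
  fixes \<phi> :: "real \<Rightarrow> real \<Rightarrow> real" and s\<^sub>0 g\<^sub>0 R K :: real
  assumes N: "N \<ge> (1::nat)" and R: "R > 0" and K: "K \<ge> 0"
    and lip: "\<And>u v g h. \<bar>\<phi> u g - \<phi> v h\<bar> \<le> K * (\<bar>u - v\<bar> + \<bar>g - h\<bar>)"
  obtains u g where "continuous_on {0..R} u" "continuous_on {0..R} g" "u 0 = s\<^sub>0" "g 0 = g\<^sub>0"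
    "\<And>x. 0 < x \<Longrightarrow> x < R \<Longrightarrow> (g has_real_derivative x * u x) (at x)"
    "\<And>x. 0 < x \<Longrightarrow> x < R \<Longrightarrow>
       (u has_real_derivative real N * (s\<^sub>0 - u x) / x - x * \<phi> (u x) (g x)) (at x)"
proof -
  define G where "G u x = g\<^sub>0 + integral {0..x} (\<lambda>t. t * u t)" for u :: "real \<Rightarrow> real" and x
  define j where "j u t = t ^ (N+1) * \<phi> (u t) (G u t)" for u t
  define T where "T u x = s\<^sub>0 - integral {0..x} (j u) / x ^ N" for u x
  define L where "L = 1 + 2 * (R * K * (1 + R))"
  have L: "L \<ge> 1" using R K by (auto simp: L_def)
  then have L0: "L > 0" by simp
  have Gcont: "continuous_on {0..R} (G u)" if "continuous_on {0..R} u" for u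
    unfolding G_def using that
    by (intro continuous_intros indefinite_integral_continuous_1 integrable_continuous_interval)
  have \<phi>cont: "continuous_on {0..R} (\<lambda>t. \<phi> (u t) (G u t))" if u: "continuous_on {0..R} u" for u
    unfolding continuous_on_def
  proof
    fix x assume x: "x \<in> {0..R}"
    show "((\<lambda>t. \<phi> (u t) (G u t)) \<longlongrightarrow> \<phi> (u x) (G u x)) (at x within {0..R})"
    proof (rule LIM_zero_cancel, rule Lim_null_comparison)
      show "\<forall>\<^sub>F t in at x within {0..R}. norm (\<phi> (u t) (G u t) - \<phi> (u x) (G u x)) \<le>
          K * (\<bar>u t - u x\<bar> + \<bar>G u t - G u x\<bar>)"
        using lip by simp
      have "(u \<longlongrightarrow> u x) (at x within {0..R})" "(G u \<longlongrightarrow> G u x) (at x within {0..R})"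
        using u Gcont[OF u] x by (auto simp: continuous_on_def)
      then show "((\<lambda>t. K * (\<bar>u t - u x\<bar> + \<bar>G u t - G u x\<bar>)) \<longlongrightarrow> 0) (at x within {0..R})"
        by (auto intro!: tendsto_eq_intros)
    qed
  qed
  have jcont: "continuous_on {0..R} (j u)" if u: "continuous_on {0..R} u" for u
    unfolding j_def using \<phi>cont[OF u] by (intro continuous_intros)
  have int_sub: "w integrable_on {0..x}" if "continuous_on {0..R} w" "x \<in> {0..R}" for w :: "real \<Rightarrow> real" and x
    using that by (intro integrable_continuous_interval) (auto intro: continuous_on_subset)
  have Tcont: "continuous_on {0..R} (T u)" if u: "continuous_on {0..R} u" for u
    unfolding continuous_on_eq_continuous_within
  proof
    fix x assume x: "x \<in> {0..R}"
    have ic: "continuous_on {0..R} (\<lambda>x. integral {0..x} (j u))"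
      by (intro indefinite_integral_continuous_1 integrable_continuous_interval jcont u)
    show "continuous (at x within {0..R}) (T u)"
    proof (cases "x = 0")
      case False
      then show ?thesis unfolding T_def using ic x
        by (intro continuous_intros) (auto simp: continuous_on_eq_continuous_within)
    next
      case True
      obtain B where B: "\<And>t. t \<in> {0..R} \<Longrightarrow> \<bar>\<phi> (u t) (G u t)\<bar> \<le> B" and B0: "B \<ge> 0"
        using continuous_abs_bounded[OF \<phi>cont[OF u]] by metis
      have bound: "\<bar>T u y - s\<^sub>0\<bar> \<le> B * y\<^sup>2" if y: "y \<in> {0..R}" for y
      proof (cases "y = 0")
        case True then show ?thesis using N by (simp add: T_def)
      next
        case False
        then have y0: "y > 0" using y by auto
        have "norm (integral {0..y} (j u)) \<le> integral {0..y} (\<lambda>t. y ^ (N+1) * B)"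
        proof (rule integral_norm_bound_integral)
          show "norm (j u t) \<le> y ^ (N+1) * B" if "t \<in> {0..y}" for t
          proof -
            have "\<bar>t ^ (N+1)\<bar> * \<bar>\<phi> (u t) (G u t)\<bar> \<le> y ^ (N+1) * B"
              using that y power_mono[of t y "N+1"] by (intro mult_mono B) auto
            then show ?thesis by (simp only: j_def real_norm_def abs_mult)
          qed
        qed (use jcont[OF u] y int_sub in auto)
        then have "\<bar>integral {0..y} (j u)\<bar> \<le> y ^ N * (B * y\<^sup>2)" using y0 by (simp add: power2_eq_square mult_ac)
        then show ?thesis using y0 by (simp add: T_def abs_divide divide_simps mult_ac)
      qed
      have "(T u \<longlongrightarrow> s\<^sub>0) (at 0 within {0..R})"
      proof (rule LIM_zero_cancel, rule Lim_null_comparison)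
        show "\<forall>\<^sub>F y in at 0 within {0..R}. norm (T u y - s\<^sub>0) \<le> B * y\<^sup>2"
          using bound by (auto simp: eventually_at intro!: exI[of _ 1])
        show "((\<lambda>y. B * y\<^sup>2) \<longlongrightarrow> 0) (at 0 within {0..R})" by (auto intro!: tendsto_eq_intros)
      qed
      moreover have "T u 0 = s\<^sub>0" by (simp add: T_def)
      ultimately show ?thesis using True by (simp add: continuous_within)
    qed
  qed
  have contr: "\<bar>T u x - T v x\<bar> \<le> d / 2 * exp (L * x)"
    if u: "continuous_on {0..R} u" and v: "continuous_on {0..R} v"
      and d: "\<And>t. t \<in> {0..R} \<Longrightarrow> \<bar>u t - v t\<bar> \<le> d * exp (L * t)" and x: "x \<in> {0..R}" for u v d x
  proof -
    have d0: "d \<ge> 0" using d[of 0] R by auto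
    have GG: "\<bar>G u t - G v t\<bar> \<le> R * (d * exp (L * t))" if t: "t \<in> {0..R}" for t
    proof -
      have i1: "(\<lambda>t. t * u t) integrable_on {0..t}" "(\<lambda>t. t * v t) integrable_on {0..t}"
        using u v t by (auto intro!: int_sub continuous_intros)
      have "G u t - G v t = integral {0..t} (\<lambda>r. r * u r - r * v r)"
        using i1 by (simp add: G_def integral_diff)
      also have "norm \<dots> \<le> integral {0..t} (\<lambda>r. R * d * exp (L * r))"
      proof (rule integral_norm_bound_integral)
        show "norm (r * u r - r * v r) \<le> R * d * exp (L * r)" if "r \<in> {0..t}" for r
        proof -
          have "\<bar>r\<bar> * \<bar>u r - v r\<bar> \<le> R * (d * exp (L * r))"
            using that t by (intro mult_mono d) auto
          then show ?thesis by (simp add: right_diff_distrib[symmetric] abs_mult mult.assoc)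
        qed
      qed (rule integrable_diff[OF i1], intro integrable_continuous_interval continuous_intros)
      also have "\<dots> = R * d * integral {0..t} (\<lambda>r. exp (L * r))" by simp
      also have "\<dots> \<le> R * d * (exp (L * t) / L)"
        using integral_exp_le[of L t] L0 d0 R t by (intro mult_left_mono) auto
      also have "\<dots> \<le> R * d * exp (L * t)"
        using L L0 d0 R by (intro mult_left_mono) (auto simp: divide_simps)
      finally show ?thesis by (simp add: mult.assoc)
    qed
    show ?thesis
    proof (cases "x = 0")
      case True then show ?thesis using d0 by (simp add: T_def)
    next
      case False
      then have x0: "x > 0" using x by auto
      have ij: "j u integrable_on {0..x}" "j v integrable_on {0..x}"
        using int_sub[OF jcont[OF u] x] int_sub[OF jcont[OF v] x] by auto
      define c where "c = K * (1 + R) * d"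
      have c0: "c \<ge> 0" using K R d0 by (simp add: c_def)
      have "norm (integral {0..x} (\<lambda>t. j u t - j v t)) \<le> integral {0..x} (\<lambda>t. x ^ (N+1) * c * exp (L * t))"
      proof (rule integral_norm_bound_integral)
        show "norm (j u t - j v t) \<le> x ^ (N+1) * c * exp (L * t)" if "t \<in> {0..x}" for t
        proof -
          have t: "t \<in> {0..R}" using that x by auto
          have "\<bar>\<phi> (u t) (G u t) - \<phi> (v t) (G v t)\<bar> \<le> K * (\<bar>u t - v t\<bar> + \<bar>G u t - G v t\<bar>)" by (rule lip)
          also have "\<dots> \<le> K * (d * exp (L * t) + R * (d * exp (L * t)))"
            using K d[OF t] GG[OF t] by (intro mult_left_mono) auto
          finally have 1: "\<bar>\<phi> (u t) (G u t) - \<phi> (v t) (G v t)\<bar> \<le> c * exp (L * t)"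
            by (simp add: c_def algebra_simps)
          have "\<bar>t ^ (N+1)\<bar> * \<bar>\<phi> (u t) (G u t) - \<phi> (v t) (G v t)\<bar> \<le> x ^ (N+1) * (c * exp (L * t))"
            using that power_mono[of t x "N+1"] x0 by (intro mult_mono 1) auto
          then show ?thesis by (simp only: j_def real_norm_def abs_mult right_diff_distrib[symmetric] mult.assoc)
        qed
      qed (rule integrable_diff[OF ij], intro integrable_continuous_interval continuous_intros)
      also have "\<dots> = x ^ (N+1) * c * integral {0..x} (\<lambda>t. exp (L * t))" by simp
      also have "\<dots> \<le> x ^ (N+1) * c * (exp (L * x) / L)"
        using integral_exp_le[of L x] L0 c0 x0 by (intro mult_left_mono) auto
      finally have "\<bar>integral {0..x} (\<lambda>t. j u t - j v t)\<bar> / x ^ N \<le> x * c * (exp (L * x) / L)"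
        using x0 by (simp add: pos_divide_le_eq mult_ac)
      moreover have "T u x - T v x = - integral {0..x} (\<lambda>t. j u t - j v t) / x ^ N"
        using ij by (simp add: T_def integral_diff diff_divide_distrib)
      ultimately have "\<bar>T u x - T v x\<bar> \<le> x * c * (exp (L * x) / L)"
        using x0 by (simp add: abs_divide)
      also have "\<dots> \<le> R * c * (exp (L * x) / L)"
        using x c0 L0 by (intro mult_right_mono) auto
      also have "\<dots> \<le> d / 2 * exp (L * x)"
      proof -
        have "2 * (R * c) \<le> d * L" using d0 by (simp add: c_def L_def algebra_simps)
        then have "R * c / L \<le> d / 2" using L0 by (simp add: divide_simps mult_ac)
        then have "R * c / L * exp (L * x) \<le> d / 2 * exp (L * x)" by (intro mult_right_mono) auto
        then show ?thesis by simp
      qed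
      finally show ?thesis .
    qed
  qed
  obtain u where u: "continuous_on {0..R} u" and fix_u: "\<And>x. x \<in> {0..R} \<Longrightarrow> T u x = u x"
    using weighted_picard[of L R T] L0 Tcont contr by auto
  have dint: "((\<lambda>x. integral {0..x} w) has_real_derivative w x) (at x)"
    if "continuous_on {0..R} w" "0 < x" "x < R" for w :: "real \<Rightarrow> real" and x
  proof -
    have "((\<lambda>x. integral {0..x} w) has_real_derivative w x) (at x within {0..R})"
      using that by (intro integral_has_real_derivative) auto
    then show ?thesis using that at_within_Icc_at[of 0 x R] by simp
  qed
  have dG: "(G u has_real_derivative x * u x) (at x)" if "0 < x" "x < R" for x
  proof -
    have "continuous_on {0..R} (\<lambda>t. t * u t)" using u by (intro continuous_intros)
    from dint[OF this that] show ?thesis unfolding G_def by (auto intro!: derivative_eq_intros)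
  qed
  have dT: "(T u has_real_derivative real N * (s\<^sub>0 - u x) / x - x * \<phi> (u x) (G u x)) (at x)"
    if x: "0 < x" "x < R" for x
  proof -
    let ?I = "integral {0..x} (j u)"
    have I: "?I = (s\<^sub>0 - u x) * x ^ N" using fix_u[of x] x by (auto simp: T_def field_simps)
    have "(T u has_real_derivative - ((j u x * x ^ N - ?I * (real N * x ^ (N - 1))) / (x ^ N * x ^ N))) (at x)"
      unfolding T_def using dint[OF jcont[OF u] x] x
      by (auto intro!: derivative_eq_intros)
    moreover have "- ((j u x * x ^ N - ?I * (real N * x ^ (N - 1))) / (x ^ N * x ^ N))
       = real N * (s\<^sub>0 - u x) / x - x * \<phi> (u x) (G u x)"
    proof -
      have xN: "x ^ N = x * x ^ (N - 1)" using N by (cases N) auto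
      have "- ((x * (x * w) * p * (x * w) - d * (x * w) * (real N * w)) / ((x * w) * (x * w)))
          = real N * d / x - x * p" if "w \<noteq> 0" for w p d
        using that x by (simp add: divide_simps) (simp add: algebra_simps)
      from this[of "x ^ (N - 1)"] x show ?thesis
        unfolding I j_def Suc_eq_plus1[symmetric] power_Suc xN by simp

    qed
    ultimately show ?thesis by simp
  qed
  have du: "(u has_real_derivative real N * (s\<^sub>0 - u x) / x - x * \<phi> (u x) (G u x)) (at x)"
    if x: "0 < x" "x < R" for x
    by (rule has_field_derivative_transform_within_open[OF dT[OF x], of "{0<..<R}"])
      (use x fix_u in auto)
  show ?thesis
  proof (rule that[of u "G u"])
    show "u 0 = s\<^sub>0" using fix_u[of 0] R by (simp add: T_def)
    show "G u 0 = g\<^sub>0" by (simp add: G_def)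
  qed (use u Gcont dG du in auto)
qed

section \<open>The first order system for pressure and slope\<close>

lemma continuous_pos_bounded_below:
  fixes h :: "real \<Rightarrow> real"
  assumes "continuous_on {a..b} h" "\<And>t. t \<in> {a..b} \<Longrightarrow> h t > 0"
  obtains c where "c > 0" "\<And>t. t \<in> {a..b} \<Longrightarrow> c \<le> h t"
proof (cases "a \<le> b")
  case True
  then obtain t where "t \<in> {a..b}" "\<And>x. x \<in> {a..b} \<Longrightarrow> h t \<le> h x"
    using continuous_attains_inf[of "{a..b}" h] assms(1) by auto
  then show ?thesis using that[of "h t"] assms(2) by blast
next
  case False
  then show ?thesis using that[of 1] by auto
qed

text \<open>
  The parameter \<open>a\<close> stands for \<open>1/(m-1)\<close>; it exceeds \<open>1\<close> because \<open>m + p = 2\<close> and \<open>p > 0\<close> give \<open>m < 2\<close>.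
\<close>

locale profile_flow =
  fixes N :: nat and a \<alpha> :: real
  assumes N: "N \<ge> 1" and a: "a > 1" and \<alpha>: "\<alpha> > 0"
begin

text \<open>
  The possible limits of the slope at an interface are the roots of \<open>Q\<close>.
\<close>

definition Q :: "real \<Rightarrow> real" where "Q s = a * (a + 1) * s\<^sup>2 + \<alpha> / 2 * s + 1"

text \<open>
  The only value of the slope for which the terms singular at \<open>x = 0\<close> cancel.
\<close>

definition s\<^sub>0 :: real where "s\<^sub>0 = \<alpha> / ((a + 1) * real N)"

definition flow :: "real \<Rightarrow> (real \<Rightarrow> real) \<Rightarrow> (real \<Rightarrow> real) \<Rightarrow> bool" where
  "flow X s g \<longleftrightarrow> (\<forall>x. 0 < x \<and> x < X \<longrightarrow>
     g x > 0 \<and> (g has_real_derivative x * s x) (at x) \<and>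
     (s has_real_derivative real N * (s\<^sub>0 - s x) / x - x * (Q (s x) / ((a + 1) * g x))) (at x))"

definition central :: "real \<Rightarrow> (real \<Rightarrow> real) \<Rightarrow> (real \<Rightarrow> real) \<Rightarrow> bool" where
  "central X s g \<longleftrightarrow> 0 < X \<and> flow X s g \<and> s 0 = s\<^sub>0 \<and> g 0 = 1 \<and>
     (s \<longlongrightarrow> s\<^sub>0) (at_right 0) \<and> (g \<longlongrightarrow> 1) (at_right 0)"

lemma s0_pos: "s\<^sub>0 > 0"
  using N a \<alpha> by (simp add: s\<^sub>0_def)

lemma Q_cont [continuous_intros]: "continuous_on S f \<Longrightarrow> continuous_on S (\<lambda>x. Q (f x))"
  unfolding Q_def by (intro continuous_intros)

lemma flowD:
  assumes "flow X s g" "0 < x" "x < X"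
  shows "g x > 0" "(g has_real_derivative x * s x) (at x)"
    "(s has_real_derivative real N * (s\<^sub>0 - s x) / x - x * (Q (s x) / ((a + 1) * g x))) (at x)"
  using assms by (auto simp: flow_def)

lemma central_continuous:
  assumes "central X s g" "x < X"
  shows "continuous_on {0..x} s" "continuous_on {0..x} g"
proof -
  have "continuous (at y within {0..x}) s \<and> continuous (at y within {0..x}) g" if "y \<in> {0..x}" for y
  proof (cases "y = 0")
    case True
    then show ?thesis
    proof (cases "x = 0")
      case False
      then have "at y within {0..x} = at_right 0"
        using that True at_within_Icc_at_right[of 0 x] by auto
      then show ?thesis using assms True by (auto simp: continuous_within central_def)
    qed (use that continuous_on_sing[of 0 s] continuous_on_sing[of 0 g] in
        \<open>auto simp: continuous_on_eq_continuous_within\<close>)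
  next
    case False
    then have y: "flow X s g" "0 < y" "y < X" using that assms by (auto simp: central_def)
    have "isCont s y" "isCont g y"
      by (rule DERIV_isCont[OF flowD(3)[OF y]], rule DERIV_isCont[OF flowD(2)[OF y]])
    then show ?thesis by (auto intro: continuous_at_imp_continuous_within)
  qed
  then show "continuous_on {0..x} s" "continuous_on {0..x} g"
    by (auto simp: continuous_on_eq_continuous_within)
qed

lemma central_pos: "central X s g \<Longrightarrow> 0 \<le> x \<Longrightarrow> x < X \<Longrightarrow> g x > 0"
  by (cases "x = 0") (auto simp: central_def flow_def)

lemma forcing_lipschitz:
  assumes B: "B \<ge> 0" and c: "c > 0"
  obtains K where "K \<ge> 0" "\<And>u v g h. \<bar>u\<bar> \<le> B \<Longrightarrow> \<bar>v\<bar> \<le> B \<Longrightarrow> c \<le> g \<Longrightarrow> c \<le> h \<Longrightarrow>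
     \<bar>Q u / ((a + 1) * g) - Q v / ((a + 1) * h)\<bar> \<le> K * (\<bar>u - v\<bar> + \<bar>g - h\<bar>)"
proof -
  define K\<^sub>1 where "K\<^sub>1 = a * (a + 1) * (B + B) + \<alpha> / 2"
  define M where "M = a * (a + 1) * B\<^sup>2 + \<alpha> / 2 * B + 1"
  define K where "K = K\<^sub>1 / c + M / (c * c)"
  have pos: "K\<^sub>1 \<ge> 0" "M \<ge> 0" using B a \<alpha> by (auto simp: K\<^sub>1_def M_def)
  have "\<bar>Q u / ((a + 1) * g) - Q v / ((a + 1) * h)\<bar> \<le> K * (\<bar>u - v\<bar> + \<bar>g - h\<bar>)"
    if *: "\<bar>u\<bar> \<le> B" "\<bar>v\<bar> \<le> B" "c \<le> g" "c \<le> h" for u v g h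
  proof -
    have gh: "g > 0" "h > 0" using * c by auto
    have "Q u - Q v = (a * (a + 1) * (u + v) + \<alpha> / 2) * (u - v)"
      by (simp add: Q_def power2_eq_square field_simps)
    moreover have "\<bar>a * (a + 1) * (u + v) + \<alpha> / 2\<bar> \<le> K\<^sub>1"
    proof -
      have "\<bar>a * (a + 1) * (u + v)\<bar> \<le> a * (a + 1) * (B + B)"
        using * a by (simp only: abs_mult) (intro mult_mono, auto)
      then show ?thesis using \<alpha> unfolding K\<^sub>1_def by linarith
    qed
    ultimately have 1: "\<bar>Q u - Q v\<bar> \<le> K\<^sub>1 * \<bar>u - v\<bar>" by (simp add: abs_mult mult_right_mono)
    have 2: "\<bar>Q v\<bar> \<le> M"
    proof -
      have "v\<^sup>2 \<le> B\<^sup>2" using * B by (metis abs_le_square_iff abs_of_nonneg)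
      then have "a * (a + 1) * v\<^sup>2 \<le> a * (a + 1) * B\<^sup>2" using a by (intro mult_left_mono) auto
      moreover have "\<bar>\<alpha> / 2 * v\<bar> \<le> \<alpha> / 2 * B" using * \<alpha> by (simp add: abs_mult)
      moreover have "a * (a + 1) * v\<^sup>2 \<ge> 0" using a by simp
      ultimately show ?thesis unfolding Q_def M_def by linarith
    qed
    have "\<bar>Q u - Q v\<bar> / g \<le> K\<^sub>1 * \<bar>u - v\<bar> / c"
      using 1 * c gh pos by (intro frac_le) auto
    moreover have "\<bar>Q v\<bar> * \<bar>h - g\<bar> / (g * h) \<le> M * \<bar>h - g\<bar> / (c * c)"
      using 2 * c gh pos by (intro frac_le mult_mono) auto
    moreover have "\<bar>Q u / g - Q v / h\<bar> \<le> \<bar>Q u - Q v\<bar> / g + \<bar>Q v\<bar> * \<bar>h - g\<bar> / (g * h)"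
    proof -
      have "Q u / g - Q v / h = (Q u - Q v) / g + Q v * (h - g) / (g * h)"
        using gh by (simp add: field_simps)
      also have "\<bar>\<dots>\<bar> \<le> \<bar>(Q u - Q v) / g\<bar> + \<bar>Q v * (h - g) / (g * h)\<bar>" by (rule abs_triangle_ineq)
      finally show ?thesis using gh by (simp add: abs_mult)
    qed
    moreover have "K\<^sub>1 * \<bar>u - v\<bar> / c + M * \<bar>h - g\<bar> / (c * c) \<le> K * (\<bar>u - v\<bar> + \<bar>g - h\<bar>)"
    proof -
      have "0 \<le> K\<^sub>1 / c * \<bar>g - h\<bar>" "0 \<le> M / (c * c) * \<bar>u - v\<bar>" using pos c by auto
      then show ?thesis unfolding K_def by (simp add: algebra_simps abs_minus_commute)
    qed
    ultimately have "\<bar>Q u / g - Q v / h\<bar> \<le> K * (\<bar>u - v\<bar> + \<bar>g - h\<bar>)" by linarith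
    moreover have "\<bar>Q u / ((a + 1) * g) - Q v / ((a + 1) * h)\<bar> \<le> \<bar>Q u / g - Q v / h\<bar>"
    proof -
      have "Q u / ((a + 1) * g) - Q v / ((a + 1) * h) = (Q u / g - Q v / h) / (a + 1)"
        by (simp add: diff_divide_distrib mult.commute)
      then show ?thesis using a
        by (simp add: abs_divide divide_le_eq mult_left_le algebra_simps)
    qed
    ultimately show ?thesis by linarith
  qed
  moreover have "K \<ge> 0" using pos c by (simp add: K_def)
  ultimately show ?thesis using that by blast
qed

section \<open>Uniqueness of the central solution\<close>

text \<open>
  In the derivative of \<open>V = (s - t)\<^sup>2 + (g - h)\<^sup>2\<close> the singular terms contribute
  \<open>- 2 N (s - t)\<^sup>2 / x \<le> 0\<close>, and the rest is at most \<open>C V\<close>. So \<open>exp(-C x) V\<close> is nonincreasing, and it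
  tends to \<open>0\<close> at the centre.
\<close>

lemma central_unique:
  assumes 1: "central X s g" and 2: "central Y t h" and x: "0 \<le> x" "x < X" "x < Y"
  shows "s x = t x" "g x = h x"
proof -
  have "s x = t x \<and> g x = h x"
  proof (cases "x = 0")
    case True then show ?thesis using 1 2 by (auto simp: central_def)
  next
    case False
    then have x0: "x > 0" using x by simp
    obtain b where b: "x < b" "b < X" "b < Y" using x dense[of x "min X Y"] by auto
    have fl: "flow X s g" "flow Y t h" using 1 2 by (auto simp: central_def)
    obtain B1 B2 where B1: "B1 \<ge> 0" "\<And>y. y \<in> {0..b} \<Longrightarrow> \<bar>s y\<bar> \<le> B1"
      and B2: "B2 \<ge> 0" "\<And>y. y \<in> {0..b} \<Longrightarrow> \<bar>t y\<bar> \<le> B2"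
      using continuous_abs_bounded central_continuous(1)[OF 1 b(2)] central_continuous(1)[OF 2 b(3)]
      by metis
    obtain c1 where c1: "c1 > 0" "\<And>y. y \<in> {0..b} \<Longrightarrow> c1 \<le> g y"
      using continuous_pos_bounded_below[OF central_continuous(2)[OF 1 b(2)]] central_pos[OF 1] b by auto
    obtain c2 where c2: "c2 > 0" "\<And>y. y \<in> {0..b} \<Longrightarrow> c2 \<le> h y"
      using continuous_pos_bounded_below[OF central_continuous(2)[OF 2 b(3)]] central_pos[OF 2] b by auto
    obtain K where K: "K \<ge> 0" "\<And>u v g h. \<bar>u\<bar> \<le> max B1 B2 \<Longrightarrow> \<bar>v\<bar> \<le> max B1 B2 \<Longrightarrow>
        min c1 c2 \<le> g \<Longrightarrow> min c1 c2 \<le> h \<Longrightarrow>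
        \<bar>Q u / ((a + 1) * g) - Q v / ((a + 1) * h)\<bar> \<le> K * (\<bar>u - v\<bar> + \<bar>g - h\<bar>)"
      using forcing_lipschitz[of "max B1 B2" "min c1 c2"] B1(1) c1(1) c2(1) by (auto simp: le_max_iff_disj)
    \<comment> \<open>from \<open>\<bar>p\<bar> (\<bar>p\<bar> + \<bar>q\<bar>) \<le> 2 V\<close> and \<open>2 \<bar>p\<bar> \<bar>q\<bar> \<le> V\<close> for the differences \<open>p\<close>, \<open>q\<close> of slopes and pressures\<close>
    define C where "C = b * (4 * K + 1)"
    define V where "V y = (s y - t y)\<^sup>2 + (g y - h y)\<^sup>2" for y
    have "exp (- C * x) * V x \<le> 0"
    proof (rule nonincreasing_from_limit[of "\<lambda>y. exp (- C * y) * V y" 0 0 x b])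
      have "(s \<longlongrightarrow> s\<^sub>0) (at_right 0)" "(t \<longlongrightarrow> s\<^sub>0) (at_right 0)"
        "(g \<longlongrightarrow> 1) (at_right 0)" "(h \<longlongrightarrow> 1) (at_right 0)" using 1 2 by (auto simp: central_def)
      then show "((\<lambda>y. exp (- C * y) * V y) \<longlongrightarrow> 0) (at_right 0)"
        unfolding V_def by (auto intro!: tendsto_eq_intros)
      fix y assume y: "0 < y" "y < b"
      define p where "p = s y - t y"
      define q where "q = g y - h y"
      define e where "e = Q (s y) / ((a + 1) * g y) - Q (t y) / ((a + 1) * h y)"
      have e: "\<bar>e\<bar> \<le> K * (\<bar>p\<bar> + \<bar>q\<bar>)"
        unfolding e_def p_def q_def using y B1(2)[of y] B2(2)[of y] c1(2)[of y] c2(2)[of y]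
        by (intro K(2)) auto
      define V' where "V' = 2 * p * (- real N * p / y - y * e) + 2 * q * (y * p)"
      have "(V has_real_derivative V') (at y)"
        unfolding V_def
        apply (rule derivative_eq_intros flowD[OF fl(1)] flowD[OF fl(2)] | use y b in simp)+
        unfolding V'_def p_def q_def e_def using y by (simp add: field_simps)
      then have "((\<lambda>y. exp (- C * y) * V y) has_real_derivative exp (- C * y) * (V' - C * V y)) (at y)"
        by (auto intro!: derivative_eq_intros simp: algebra_simps)
      moreover have "V' \<le> C * V y"
      proof -
        have Vy: "V y = \<bar>p\<bar>\<^sup>2 + \<bar>q\<bar>\<^sup>2" by (simp add: V_def p_def q_def)
        have pq: "2 * (\<bar>p\<bar> * \<bar>q\<bar>) \<le> V y"
          using zero_le_power2[of "\<bar>p\<bar> - \<bar>q\<bar>"] unfolding Vy power2_diff by simp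
        have "- (p * e) \<le> \<bar>p\<bar> * \<bar>e\<bar>" by (metis abs_ge_minus_self abs_mult)
        also have "\<dots> \<le> \<bar>p\<bar> * (K * (\<bar>p\<bar> + \<bar>q\<bar>))" using e by (intro mult_left_mono) auto
        also have "\<dots> = K * (\<bar>p\<bar>\<^sup>2 + \<bar>p\<bar> * \<bar>q\<bar>)" by (simp add: power2_eq_square algebra_simps)
        also have "\<dots> \<le> K * (2 * V y)"
        proof (intro mult_left_mono K(1))
          have "v \<ge> 0 \<Longrightarrow> w \<ge> 0 \<Longrightarrow> 2 * z \<le> v + w \<Longrightarrow> v + z \<le> 2 * (v + w)" for v w z :: real by simp
          from this[OF _ _ pq[unfolded Vy]] show "\<bar>p\<bar>\<^sup>2 + \<bar>p\<bar> * \<bar>q\<bar> \<le> 2 * V y" unfolding Vy by simp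
        qed
        finally have 3: "- (p * e) \<le> K * (2 * V y)" .
        have 4: "p * q \<le> V y / 2" using pq abs_ge_self[of "p * q"] by (simp add: abs_mult)
        have "V' = - (2 * real N * p\<^sup>2 / y) + 2 * y * (- (p * e) + p * q)"
          using y by (simp add: V'_def field_simps power2_eq_square)
        also have "\<dots> \<le> 2 * y * (K * (2 * V y) + V y / 2)"
        proof -
          have "0 \<le> 2 * real N * p\<^sup>2 / y" using y by auto
          moreover have "2 * y * (- (p * e) + p * q) \<le> 2 * y * (K * (2 * V y) + V y / 2)"
            using 3 4 y by (intro mult_left_mono) auto
          ultimately show ?thesis by linarith
        qed
        also have "\<dots> = y * ((4 * K + 1) * V y)" by (simp add: algebra_simps)
        also have "\<dots> \<le> b * ((4 * K + 1) * V y)" using y K by (intro mult_right_mono) (auto simp: Vy)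
        finally show ?thesis by (simp add: C_def)
      qed
      ultimately show "\<exists>D\<le>0. ((\<lambda>y. exp (- C * y) * V y) has_real_derivative D) (at y)"
        by (intro exI[of _ "exp (- C * y) * (V' - C * V y)"]) (auto simp: mult_le_0_iff)
    qed (use x0 b in auto)
    then have "V x \<le> 0" by (simp add: mult_le_0_iff)
    moreover have "0 \<le> (s x - t x)\<^sup>2" "0 \<le> (g x - h x)\<^sup>2" by simp_all
    ultimately have "(s x - t x)\<^sup>2 = 0" "(g x - h x)\<^sup>2 = 0" unfolding V_def by linarith+
    then show ?thesis by simp
  qed
  then show "s x = t x" "g x = h x" by auto
qed

section \<open>Behaviour of the slope near an interface\<close>

text \<open>
  If \<open>Q(s) \<ge> q > 0\<close> and \<open>s\<close> is bounded below, then for small \<open>l > 0\<close> the term \<open>- x (Q(s)/(a+1) + l s)/g\<close>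
  dominates the derivative of \<open>s - l ln g\<close>. This function is then nonincreasing near the interface,
  although it must tend to \<open>+\<infinity>\<close> there.
\<close>

lemma interface_slope_critical:
  assumes X: "X > 0" and fl: "flow X s g" and g0: "(g \<longlongrightarrow> 0) (at_left X)" and q: "q > 0"
    and ev: "\<forall>\<^sub>F x in at_left X. - B \<le> s x \<and> q \<le> Q (s x)"
  shows False
proof -
  define B' where "B' = max B 0"
  \<comment> \<open>chosen so that \<open>l s \<ge> - l B' \<ge> - q'\<close> costs at most half of \<open>q/(a+1) \<le> Q(s)/(a+1)\<close>\<close>
  define l where "l = q / (2 * (a + 1) * (B' + 1))"
  define q' where "q' = q / (2 * (a + 1))"
  define D where "D = real N * (s\<^sub>0 + B')"
  have B': "B' \<ge> 0" "B \<le> B'" by (auto simp: B'_def)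
  have l: "l > 0" "q' > 0" using q a B' by (auto simp: l_def q'_def)
  have lB: "l * B' \<le> q'" using q a B' by (simp add: l_def q'_def divide_simps)
  have D: "D > 0" using N s0_pos B' by (simp add: D_def)
  have "\<forall>\<^sub>F x in at_left X. g x < q' * X\<^sup>2 / (4 * D)"
    using g0 l D X by (intro order_tendstoD) auto
  with ev have "\<forall>\<^sub>F x in at_left X. - B \<le> s x \<and> q \<le> Q (s x) \<and> g x < q' * X\<^sup>2 / (4 * D)"
    by eventually_elim auto
  then obtain b' where b': "b' < X" "\<And>y. b' < y \<Longrightarrow> y < X \<Longrightarrow>
      - B \<le> s y \<and> q \<le> Q (s y) \<and> g y < q' * X\<^sup>2 / (4 * D)"
    using eventually_at_left[of 0 X] X by auto
  define b where "b = max b' (X / 2)"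
  have b: "b < X" "X / 2 \<le> b" "b' \<le> b" using b' X by (auto simp: b_def)
  define V where "V y = s y - l * ln (g y)" for y
  define y\<^sub>0 where "y\<^sub>0 = (b + X) / 2"
  have y0: "b < y\<^sub>0" "y\<^sub>0 < X" using b by (auto simp: y\<^sub>0_def)
  have dV: "\<exists>D'\<le>0. (V has_real_derivative D') (at y)" if y: "b < y" "y < X" for y
  proof -
    have y0: "0 < y" using y b X by auto
    note f = flowD[OF fl y0 y(2)]
    define V' where "V' = real N * (s\<^sub>0 - s y) / y - y * (Q (s y) / ((a + 1) * g y)) - l * (y * s y / g y)"
    have "(V has_real_derivative V') (at y)"
      unfolding V_def V'_def using f by (auto intro!: derivative_eq_intros)
    moreover have "V' \<le> 0"
    proof -
      have bd: "- B' \<le> s y" "q \<le> Q (s y)" "g y < q' * X\<^sup>2 / (4 * D)" using b'(2)[of y] y b B' by auto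
      have "real N * (s\<^sub>0 - s y) / y \<le> D / y"
        unfolding D_def using bd y0 by (intro divide_right_mono mult_left_mono) auto
      also have "\<dots> \<le> y / g y * q'"
      proof -
        have "X * X \<le> (2 * y) * (2 * y)" using y b X by (intro mult_mono) auto
        then have "X\<^sup>2 \<le> 4 * y\<^sup>2" by (simp add: power2_eq_square)
        then have "q' * X\<^sup>2 / (4 * D) \<le> q' * (4 * y\<^sup>2) / (4 * D)"
          using l D by (intro divide_right_mono mult_left_mono) auto
        then have "g y \<le> q' * y\<^sup>2 / D" using bd by simp
        then have "g y * D \<le> q' * y\<^sup>2" using D by (simp add: pos_le_divide_eq)
        then show ?thesis using f(1) y0 by (simp add: divide_simps power2_eq_square mult_ac)
      qed
      also have "\<dots> \<le> y / g y * (Q (s y) / (a + 1) + l * s y)"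
      proof -
        have "2 * q' = q / (a + 1)" using a unfolding q'_def by (simp add: divide_simps)
        also have "\<dots> \<le> Q (s y) / (a + 1)" using bd a by (intro divide_right_mono) auto
        finally have "q' + l * B' \<le> Q (s y) / (a + 1)" using lB by linarith
        moreover have "- (l * B') \<le> l * s y" using bd(1) l mult_left_mono[of "-B'" "s y" l] by auto
        ultimately show ?thesis using f(1) y0 by (intro mult_left_mono) auto
      qed
      finally show ?thesis by (simp add: V'_def algebra_simps)
    qed
    ultimately show ?thesis by blast
  qed
  define e where "e = exp (- ((B' + V y\<^sub>0) / l))"
  have low: "g x \<ge> e" if x: "y\<^sub>0 < x" "x < X" for x
  proof -
    have "V x \<le> V y\<^sub>0" using x y0 by (intro nonincreasing_between[of b _ _ X, OF _ _ _ dV]) auto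
    moreover have "- B' \<le> s x" using b'(2)[of x] x y0 b B' by auto
    ultimately have "- B' - V y\<^sub>0 \<le> l * ln (g x)" by (simp add: V_def)
    then have "- ((B' + V y\<^sub>0) / l) \<le> ln (g x)" using l by (simp add: divide_simps mult.commute)
    moreover have "g x > 0" using flowD(1)[OF fl] x y0 b X by auto
    ultimately show ?thesis unfolding e_def by (metis exp_le_cancel_iff exp_ln)
  qed
  have "\<forall>\<^sub>F x in at_left X. g x < e" using g0 by (intro order_tendstoD) (auto simp: e_def)
  moreover have "\<forall>\<^sub>F x in at_left X. x \<in> {y\<^sub>0<..<X}" using y0 by (intro eventually_at_left_real)
  ultimately have "\<forall>\<^sub>F x in at_left X. False" by eventually_elim (use low in force)
  then show False by simp
qed

end

context profile_flow begin

section \<open>A priori bounds when the quadratic has real roots\<close>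

lemma slope_le_initial:
  assumes lim: "(s \<longlongrightarrow> s\<^sub>0) (at_right 0)" and x: "0 < x" "x < X"
    and D: "\<And>y. 0 < y \<Longrightarrow> y < X \<Longrightarrow>
      (s has_real_derivative real N * (s\<^sub>0 - s y) / y - y * F y) (at y) \<and> 0 \<le> F y"
  shows "s x \<le> s\<^sub>0"
proof -
  have "x ^ N * (s x - s\<^sub>0) \<le> 0"
  proof (rule nonincreasing_from_limit[of "\<lambda>y. y ^ N * (s y - s\<^sub>0)" 0 0 x X])
    show "((\<lambda>y. y ^ N * (s y - s\<^sub>0)) \<longlongrightarrow> 0) (at_right 0)"
      using lim N by (auto intro!: tendsto_eq_intros)
    fix y assume y: "0 < y" "y < X"
    have yN: "y ^ N = y * y ^ (N - 1)" using N by (cases N) auto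
    have "((\<lambda>y. y ^ N * (s y - s\<^sub>0)) has_real_derivative
        real N * y ^ (N - 1) * (s y - s\<^sub>0) + y ^ N * (real N * (s\<^sub>0 - s y) / y - y * F y)) (at y)"
      using D[OF y] by (auto intro!: derivative_eq_intros)
    moreover have "real N * y ^ (N - 1) * (s y - s\<^sub>0) + y ^ N * (real N * (s\<^sub>0 - s y) / y - y * F y)
        = - (y ^ N * y * F y)"
      unfolding yN using y by (simp add: field_simps)
    moreover have "- (y ^ N * y * F y) \<le> 0" using y D[OF y] by simp
    ultimately show "\<exists>D\<le>0. ((\<lambda>y. y ^ N * (s y - s\<^sub>0)) has_real_derivative D) (at y)" by metis
  qed (use x in auto)
  then show ?thesis using zero_less_power[OF x(1), of N] by (auto simp: mult_le_0_iff)
qed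

text \<open>
  The larger root of \<open>Q\<close>. The last bound follows from \<open>- r \<le> \<alpha>/(4a(a+1))\<close>, since the two roots have
  mean \<open>- \<alpha>/(4a(a+1))\<close>, together with \<open>a > 1\<close>; it makes the Lyapunov function below positive.
\<close>

lemma critical_slope_exists:
  assumes "\<alpha> \<ge> 4 * sqrt (a * (a + 1))"
  obtains r where "r < 0" "Q r = 0" "r + \<alpha> / (2 * (a + 1)) > 0" "\<And>s. s > r \<Longrightarrow> Q s > 0"
proof -
  define d where "d = sqrt (\<alpha>\<^sup>2 / 4 - 4 * (a * (a + 1)))"
  define k where "k = a * (a + 1)"
  define r where "r = (d - \<alpha> / 2) / (2 * k)"
  have k: "k > 0" using a by (simp add: k_def)
  have "(4 * sqrt k)\<^sup>2 \<le> \<alpha>\<^sup>2" using assms k unfolding k_def by (intro power_mono) auto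
  then have disc: "\<alpha>\<^sup>2 / 4 - 4 * k \<ge> 0" using k by (simp add: power_mult_distrib)
  have d0: "d \<ge> 0" and dd: "d\<^sup>2 = \<alpha>\<^sup>2 / 4 - 4 * k" using disc by (auto simp: d_def k_def)
  have "d\<^sup>2 < (\<alpha> / 2)\<^sup>2" using dd k by (simp add: power_divide)
  then have dlt: "d < \<alpha> / 2" using \<alpha> power2_less_imp_less by fastforce
  have Qf: "Q s = k * ((s - r) * (s - r + d / k))" for s
  proof -
    have "4 * k * (k * ((s - r) * (s - r + d / k))) = (2 * k * s - 2 * k * r) * (2 * k * s - 2 * k * r + 2 * d)"
      using k by (simp add: field_simps)
    also have "2 * k * r = d - \<alpha> / 2" using k by (simp add: r_def)
    also have "(2 * k * s - (d - \<alpha> / 2)) * (2 * k * s - (d - \<alpha> / 2) + 2 * d) = (2 * k * s + \<alpha> / 2)\<^sup>2 - d\<^sup>2"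
      by (simp add: power2_eq_square algebra_simps)
    also have "\<dots> = 4 * k * Q s"
      unfolding dd Q_def k_def[symmetric] by (simp add: power2_eq_square field_simps)
    finally show ?thesis using k by simp
  qed
  show ?thesis
  proof (rule that[of r])
    show "r < 0" using dlt k by (simp add: r_def divide_less_0_iff)
    show "Q r = 0" by (simp add: Qf)
    show "Q s > 0" if "s > r" for s
      using that k d0 unfolding Qf by (intro mult_pos_pos add_pos_nonneg) auto
    have "- r \<le> \<alpha> / (4 * k)" using d0 k by (simp add: r_def divide_simps)
    also have "\<dots> < \<alpha> / (2 * (a + 1))"
    proof (rule divide_strict_left_mono)
      have "1 * (a + 1) \<le> k" unfolding k_def using a by (intro mult_right_mono) auto
      then have "4 * (a + 1) \<le> 4 * k" by simp
      moreover have "2 * (a + 1) < 4 * (a + 1)" using a by simp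
      ultimately show "2 * (a + 1) < 4 * k" by (rule less_le_trans[rotated])
    qed (use \<alpha> a k in auto)
    finally show "r + \<alpha> / (2 * (a + 1)) > 0" by simp
  qed
qed

end

text \<open>
  Here \<open>r\<close> is the larger root of \<open>Q\<close>, the slope with which the pressure will reach the interface.
\<close>

locale interface_flow = profile_flow +
  fixes r :: real
  assumes r_neg: "r < 0" and Q_r: "Q r = 0" and r_low: "r + \<alpha> / (2 * (a + 1)) > 0"
    and Q_pos: "s > r \<Longrightarrow> Q s > 0"
begin

lemma r_less_s0: "r < s\<^sub>0"
  using r_neg s0_pos by linarith

lemma Q_nonneg: "s \<ge> r \<Longrightarrow> Q s \<ge> 0"
  using Q_r Q_pos[of s] by (cases "s = r") auto

text \<open>
  At \<open>s = r\<close> the forcing vanishes, and the remaining term \<open>N (s\<^sub>0 - r)/x\<close> pushes the slope upwards.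
  The forcing is left abstract so that the bound covers the truncated system as well.
\<close>

lemma slope_gt_critical:
  assumes "continuous_on {0..x} s" "s 0 = s\<^sub>0" "0 \<le> x"
    and D: "\<And>y. 0 < y \<Longrightarrow> y \<le> x \<Longrightarrow> s y = r \<Longrightarrow>
      (s has_real_derivative real N * (s\<^sub>0 - s y) / y - y * F y) (at y) \<and> F y = 0"
  shows "s x > r"
proof (rule barrier[OF assms(1)])
  fix y assume y: "0 < y" "y \<le> x" "s y = r"
  have "real N * (s\<^sub>0 - r) / y > 0" using N r_less_s0 y by simp
  then show "\<exists>D>0. (s has_real_derivative D) (at y)" using D[OF y] y(3) by auto
qed (use r_less_s0 assms in auto)

lemma central_slope_gt:
  assumes "central X s g" "0 \<le> x" "x < X"
  shows "s x > r"
proof (rule slope_gt_critical[OF central_continuous(1)[OF assms(1,3)]])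
  show "s 0 = s\<^sub>0" using assms by (simp add: central_def)
  fix y assume y: "0 < y" "y \<le> x" "s y = r"
  have "flow X s g" using assms by (simp add: central_def)
  from flowD(3)[OF this y(1)] y assms
  show "(s has_real_derivative real N * (s\<^sub>0 - s y) / y - y * (Q (s y) / ((a + 1) * g y))) (at y) \<and>
      Q (s y) / ((a + 1) * g y) = 0"
    by (simp add: Q_r)
qed (use assms in auto)

lemma central_slope_le:
  assumes "central X s g" "0 \<le> x" "x < X"
  shows "s x \<le> s\<^sub>0"
proof (cases "x = 0")
  case False
  show ?thesis
  proof (rule slope_le_initial[of s x X "\<lambda>y. Q (s y) / ((a + 1) * g y)"])
    fix y assume y: "0 < y" "y < X"
    have "flow X s g" using assms by (simp add: central_def)
    from flowD[OF this y] Q_nonneg[OF less_imp_le[OF central_slope_gt[OF assms(1)]], of y] y a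
    show "(s has_real_derivative real N * (s\<^sub>0 - s y) / y - y * (Q (s y) / ((a + 1) * g y))) (at y) \<and>
      0 \<le> Q (s y) / ((a + 1) * g y)" by simp
  qed (use assms False in \<open>auto simp: central_def\<close>)
qed (use assms in \<open>auto simp: central_def\<close>)

lemma central_height_le:
  assumes "central X s g" "0 < x" "x < X"
  shows "g x \<le> 1 + s\<^sub>0 / 2 * x\<^sup>2"
proof -
  have fl: "flow X s g" and lim: "(g \<longlongrightarrow> 1) (at_right 0)" using assms by (auto simp: central_def)
  have "g x - s\<^sub>0 / 2 * x\<^sup>2 \<le> 1"
  proof (rule nonincreasing_from_limit[of "\<lambda>y. g y - s\<^sub>0 / 2 * y\<^sup>2" 1 0 x X])
    show "((\<lambda>y. g y - s\<^sub>0 / 2 * y\<^sup>2) \<longlongrightarrow> 1) (at_right 0)"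
      using lim by (auto intro!: tendsto_eq_intros)
    fix y assume y: "0 < y" "y < X"
    have "((\<lambda>y. g y - s\<^sub>0 / 2 * y\<^sup>2) has_real_derivative y * s y - s\<^sub>0 * y) (at y)"
      using flowD(2)[OF fl y] by (auto intro!: derivative_eq_intros)
    moreover have "y * s y - s\<^sub>0 * y \<le> 0" using central_slope_le[OF assms(1), of y] y by simp
    ultimately show "\<exists>D\<le>0. ((\<lambda>y. g y - s\<^sub>0 / 2 * y\<^sup>2) has_real_derivative D) (at y)" by blast
  qed (use assms in auto)
  then show ?thesis by simp
qed

text \<open>
  The exponent is \<open>a + 1\<close> times an upper bound at \<open>x = 1\<close> for the Lyapunov function of the next lemma.
\<close>

definition life_bound :: real where
  "life_bound = exp ((a + 1) * ((1 + s\<^sub>0 / 2) * (s\<^sub>0 + \<alpha> / (2 * (a + 1))) + (real N + 2) / 2 * (1 + s\<^sub>0 / 2)\<^sup>2))"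

text \<open>
  Let \<open>z = g/x\<^sup>2\<close>, the scale invariant pressure. Along the flow, \<open>P = z (s + \<alpha>/(2(a+1))) + (N+2)/2 z\<^sup>2\<close>
  satisfies \<open>x P' = - (a-1) s\<^sup>2 - 2 (N+2) z\<^sup>2 - 1/(a+1)\<close>. The coefficients of \<open>P\<close> are chosen to cancel
  the terms of indefinite sign. Since \<open>s > r > - \<alpha>/(2(a+1))\<close>, \<open>P\<close> stays positive, and a logarithmic rate of
  decrease bounds \<open>ln x\<close>.
\<close>

lemma central_life_bounded:
  assumes c: "central X s g"
  shows "X \<le> life_bound"
proof -
  have fl: "flow X s g" using c by (simp add: central_def)
  define z where "z x = g x / x\<^sup>2" for x
  define b where "b = \<alpha> / (2 * (a + 1))"
  define P where "P x = z x * (s x + b) + (real N + 2) / 2 * (z x)\<^sup>2" for x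
  define M where "M = (1 + s\<^sub>0 / 2) * (s\<^sub>0 + b) + (real N + 2) / 2 * (1 + s\<^sub>0 / 2)\<^sup>2"
  have b: "b > 0" using a \<alpha> by (simp add: b_def)
  have lb: "life_bound = exp ((a + 1) * M)" by (simp add: life_bound_def M_def b_def)
  have M: "M \<ge> 0" using s0_pos b by (simp add: M_def)
  have dP: "\<exists>D\<le>0. ((\<lambda>x. P x + ln x / (a + 1)) has_real_derivative D) (at x)"
    if x: "0 < x" "x < X" for x
  proof -
    note f = flowD[OF fl x]
    have dz: "(z has_real_derivative (s x - 2 * z x) / x) (at x)"
      unfolding z_def using f x
      by (auto intro!: derivative_eq_intros simp: field_simps power2_eq_square)
    have ds: "(s has_real_derivative (real N * (s\<^sub>0 - s x) - Q (s x) / ((a + 1) * z x)) / x) (at x)"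
      by (rule DERIV_cong[OF f(3)]) (use x f(1) a in \<open>simp add: z_def field_simps power2_eq_square\<close>)
    define z' where "z' = (s x - 2 * z x) / x"
    define s' where "s' = (real N * (s\<^sub>0 - s x) - Q (s x) / ((a + 1) * z x)) / x"
    define l' where "l' = 1 / x / (a + 1)"
    define D where "D = z' * (s x + b) + z x * s' + (real N + 2) * z x * z' + l'"
    have "((\<lambda>x. P x + ln x / (a + 1)) has_real_derivative D) (at x)"
      unfolding P_def D_def
    proof (rule DERIV_add)
      show "((\<lambda>x. z x * (s x + b) + (real N + 2) / 2 * (z x)\<^sup>2) has_real_derivative
          z' * (s x + b) + z x * s' + (real N + 2) * z x * z') (at x)"
        by (auto intro!: derivative_eq_intros dz[folded z'_def] ds[folded s'_def] simp: field_simps)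
      show "((\<lambda>x. ln x / (a + 1)) has_real_derivative l') (at x)"
        unfolding l'_def using x by (intro DERIV_cdivide DERIV_ln_divide)
    qed
    moreover have "D \<le> 0"
    proof -
      have z: "z x > 0" using f x by (simp add: z_def)
      have Ns: "real N * s\<^sub>0 = 2 * b" using N a unfolding s\<^sub>0_def b_def by (simp add: divide_simps)
      have Qb: "Q (s x) / (a + 1) = a * (s x)\<^sup>2 + b * s x + 1 / (a + 1)"
      proof -
        have "\<alpha> / 2 = (a + 1) * b" using a unfolding b_def by (simp add: divide_simps)
        then have "Q (s x) = (a + 1) * (a * (s x)\<^sup>2 + b * s x) + 1"
          by (simp only: Q_def) (simp add: algebra_simps)
        then show ?thesis using a by (simp add: add_divide_distrib)
      qed
      have "z x * (Q (s x) / ((a + 1) * z x)) = Q (s x) / (a + 1)" using z by simp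
      moreover have "x * z' = s x - 2 * z x"
        "x * s' = real N * (s\<^sub>0 - s x) - Q (s x) / ((a + 1) * z x)"
        using x by (simp_all add: z'_def s'_def)
      moreover have "x * D = (x * z') * (s x + b) + z x * (x * s') + (real N + 2) * z x * (x * z') + x * l'"
        by (simp add: D_def algebra_simps)
      moreover have "x * l' = 1 / (a + 1)" using x by (simp add: l'_def)
      ultimately have "x * D = (s x - 2 * z x) * (s x + b) + (z x * (real N * s\<^sub>0 - real N * s x) - Q (s x) / (a + 1))
         + (real N + 2) * z x * (s x - 2 * z x) + 1 / (a + 1)"
        by (simp add: right_diff_distrib)
      also have "\<dots> = - (a - 1) * (s x)\<^sup>2 - 2 * (real N + 2) * (z x)\<^sup>2"
        unfolding Ns Qb by (simp add: algebra_simps power2_eq_square)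
      also have "\<dots> \<le> 0"
      proof -
        have "0 \<le> (a - 1) * (s x)\<^sup>2" "0 \<le> 2 * (real N + 2) * (z x)\<^sup>2" using a by auto
        then show ?thesis by linarith
      qed
      finally show ?thesis using x by (simp add: mult_le_0_iff)
    qed
    ultimately show ?thesis by blast
  qed
  have "x \<le> life_bound" if x: "0 < x" "x < X" for x
  proof (cases "x \<le> 1")
    case True
    have "1 \<le> life_bound" unfolding lb using M a by simp
    then show ?thesis using True by linarith
  next
    case False
    have "P x + ln x / (a + 1) \<le> P 1 + ln 1 / (a + 1)"
      by (rule nonincreasing_between[of 0 1 x X]) (use x False dP in auto)
    moreover have "P 1 \<le> M"
    proof -
      have 1: "z 1 \<le> 1 + s\<^sub>0 / 2" using central_height_le[OF c, of 1] x False by (simp add: z_def)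
      have 2: "z 1 > 0" using flowD(1)[OF fl, of 1] x False by (simp add: z_def)
      have 3: "s 1 \<le> s\<^sub>0" using central_slope_le[OF c, of 1] x False by simp
      have 4: "s 1 + b > 0" using central_slope_gt[OF c, of 1] r_low x False by (simp add: b_def)
      show ?thesis unfolding P_def M_def
        using 1 2 3 4 by (intro add_mono mult_mono mult_left_mono power_mono) auto
    qed
    moreover have "P x \<ge> 0"
    proof -
      have "z x > 0" using flowD(1)[OF fl x] x by (simp add: z_def)
      moreover have "s x + b > 0" using central_slope_gt[OF c, of x] r_low x by (simp add: b_def)
      ultimately show ?thesis by (simp add: P_def)
    qed
    ultimately have "ln x / (a + 1) \<le> M" by simp
    then have "ln x \<le> (a + 1) * M" using a by (simp add: divide_le_eq mult.commute)
    then show ?thesis using x unfolding lb by (simp add: ln_le_cancel_iff[symmetric] del: ln_le_cancel_iff)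
  qed
  then show ?thesis by (rule dense_le_bounded[rotated]) (use c in \<open>auto simp: central_def\<close>)
qed

section \<open>The maximal central solution\<close>

text \<open>
  Clipping \<open>s\<close> to \<open>[r, s\<^sub>0]\<close> and \<open>g\<close> to \<open>[\<epsilon>, \<infinity>)\<close> makes the forcing globally Lipschitz, so the
  truncated system has a solution on all of \<open>[0, R]\<close>. The barriers show that the clipping of \<open>s\<close> never
  acts, and that of \<open>g\<close> acts only once \<open>g\<close> has come down to \<open>\<epsilon>\<close>.
\<close>

lemma central_while_above:
  assumes \<epsilon>: "\<epsilon> > 0" and R: "R > 0"
  obtains u h where "continuous_on {0..R} h" "h 0 = 1"
    "\<And>Y. 0 < Y \<Longrightarrow> Y \<le> R \<Longrightarrow> (\<And>x. 0 \<le> x \<Longrightarrow> x < Y \<Longrightarrow> \<epsilon> < h x) \<Longrightarrow> central Y u h"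
proof -
  define clip where "clip u = max r (min s\<^sub>0 u)" for u
  define \<phi> where "\<phi> u g = Q (clip u) / ((a + 1) * max \<epsilon> g)" for u g
  have clip: "\<bar>clip u\<bar> \<le> max (-r) s\<^sub>0" "r \<le> clip u" "\<bar>clip u - clip v\<bar> \<le> \<bar>u - v\<bar>" for u v
    using r_neg s0_pos by (auto simp: clip_def max_def min_def)
  obtain K where K: "K \<ge> 0" "\<And>u v g h. \<bar>u\<bar> \<le> max (-r) s\<^sub>0 \<Longrightarrow> \<bar>v\<bar> \<le> max (-r) s\<^sub>0 \<Longrightarrow> \<epsilon> \<le> g \<Longrightarrow> \<epsilon> \<le> h \<Longrightarrow>
     \<bar>Q u / ((a + 1) * g) - Q v / ((a + 1) * h)\<bar> \<le> K * (\<bar>u - v\<bar> + \<bar>g - h\<bar>)"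
    using forcing_lipschitz[of "max (-r) s\<^sub>0" \<epsilon>] s0_pos \<epsilon> by (auto simp: le_max_iff_disj)
  have lip: "\<bar>\<phi> u g - \<phi> v h\<bar> \<le> K * (\<bar>u - v\<bar> + \<bar>g - h\<bar>)" for u v g h
  proof -
    have "\<bar>\<phi> u g - \<phi> v h\<bar> \<le> K * (\<bar>clip u - clip v\<bar> + \<bar>max \<epsilon> g - max \<epsilon> h\<bar>)"
      unfolding \<phi>_def by (intro K clip) auto
    also have "\<dots> \<le> K * (\<bar>u - v\<bar> + \<bar>g - h\<bar>)"
      by (intro mult_left_mono add_mono clip K) (auto simp: max_def)
    finally show ?thesis .
  qed
  have \<phi>0: "\<phi> u g \<ge> 0" for u g
    using Q_nonneg[OF clip(2)[of u]] a \<epsilon> by (simp add: \<phi>_def)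
  obtain u h where uh: "continuous_on {0..R} u" "continuous_on {0..R} h" "u 0 = s\<^sub>0" "h 0 = 1"
    "\<And>x. 0 < x \<Longrightarrow> x < R \<Longrightarrow> (h has_real_derivative x * u x) (at x)"
    "\<And>x. 0 < x \<Longrightarrow> x < R \<Longrightarrow>
       (u has_real_derivative real N * (s\<^sub>0 - u x) / x - x * \<phi> (u x) (h x)) (at x)"
    using singular_ivp_exists[OF N R K(1) lip, of s\<^sub>0 1] by metis
  have lim: "(u \<longlongrightarrow> s\<^sub>0) (at_right 0)" "(h \<longlongrightarrow> 1) (at_right 0)"
    using uh(1-4) R at_within_Icc_at_right[of 0 R] by (force simp: continuous_on_def)+
  have range: "r < u x \<and> u x \<le> s\<^sub>0" if x: "0 < x" "x < R" for x
  proof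
    show "u x \<le> s\<^sub>0"
      by (rule slope_le_initial[of u x R "\<lambda>y. \<phi> (u y) (h y)", OF lim(1) x]) (use uh \<phi>0 in auto)
    show "r < u x"
    proof (rule slope_gt_critical[of x u "\<lambda>y. \<phi> (u y) (h y)"])
      show "continuous_on {0..x} u" using uh(1) x by (auto intro: continuous_on_subset)
      fix y assume y: "0 < y" "y \<le> x" "u y = r"
      have "clip r = r" using r_less_s0 by (auto simp: clip_def)
      then show "(u has_real_derivative real N * (s\<^sub>0 - u y) / y - y * \<phi> (u y) (h y)) (at y) \<and>
         \<phi> (u y) (h y) = 0"
        using uh(6)[of y] x y by (auto simp: \<phi>_def Q_r)
    qed (use uh x in auto)
  qed
  have "central Y u h" if Y: "0 < Y" "Y \<le> R" and above: "\<And>x. 0 \<le> x \<Longrightarrow> x < Y \<Longrightarrow> \<epsilon> < h x" for Y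
    unfolding central_def flow_def
  proof (intro conjI allI impI)
    fix x assume x: "0 < x \<and> x < Y"
    then have xR: "0 < x" "x < R" using Y by auto
    show "0 < h x" using above[of x] x \<epsilon> by auto
    show "(h has_real_derivative x * u x) (at x)" using uh(5) xR by auto
    have "\<phi> (u x) (h x) = Q (u x) / ((a + 1) * h x)"
      using range[OF xR] above[of x] x by (simp add: \<phi>_def clip_def)
    then show "(u has_real_derivative real N * (s\<^sub>0 - u x) / x - x * (Q (u x) / ((a + 1) * h x))) (at x)"
      using uh(6)[OF xR] by simp
  qed (use Y uh lim in auto)
  with uh show ?thesis using that by blast
qed

text \<open>
  Central solutions agree wherever two of them are defined, so they glue to a solution up to the
  supremum \<open>X\<close> of their lifetimes, which is finite. If \<open>g\<close> stayed above some \<open>\<epsilon>\<close>, the solution of the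
  system truncated at \<open>\<epsilon>/2\<close> would extend it beyond \<open>X\<close>. Hence \<open>g\<close> comes arbitrarily close to \<open>0\<close>, and the
  bound \<open>g' \<le> s\<^sub>0 X\<close> turns this into convergence.
\<close>

lemma maximal_central:
  obtains X s g where "central X s g" "(g \<longlongrightarrow> 0) (at_left X)"
proof -
  define A where "A = {X. \<exists>s g. central X s g}"
  define e :: real where "e = 1/2"
  have e: "0 < e" "e < 1" by (simp_all add: e_def)
  obtain u h where uh: "continuous_on {0..1} h" "h 0 = 1"
    "\<And>Y. 0 < Y \<Longrightarrow> Y \<le> 1 \<Longrightarrow> (\<And>x. 0 \<le> x \<Longrightarrow> x < Y \<Longrightarrow> e < h x) \<Longrightarrow> central Y u h"
    using central_while_above[OF e(1) zero_less_one] by metis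
  have "\<exists>Y. central Y u h"
  proof (cases "\<forall>x\<in>{0..1}. h x > e")
    case True
    then show ?thesis using uh(3)[of 1] by auto
  next
    case False
    then obtain x where x: "x \<in> {0..1}" "h x \<le> e" by (auto simp: not_less)
    have "e < h 0" using uh e by simp
    then obtain y where "0 < y" "y \<le> x" "\<And>t. 0 \<le> t \<Longrightarrow> t < y \<Longrightarrow> h t > e"
      using first_crossing[OF uh(1) _ x] by blast
    then show ?thesis using uh(3)[of y] x by auto
  qed
  then have A: "A \<noteq> {}" by (auto simp: A_def)
  have bdd: "bdd_above A" using central_life_bounded by (auto simp: A_def bdd_above_def)
  define X where "X = Sup A"
  have XA: "Y \<le> X" if "central Y t k" for Y t k
    unfolding X_def using bdd that by (intro cSup_upper) (auto simp: A_def)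
  have reach: "\<exists>Y t k. x < Y \<and> central Y t k" if "x < X" for x
    using that less_cSup_iff[OF A bdd] by (auto simp: X_def A_def)
  \<comment> \<open>any central solution living beyond \<open>x\<close> may be used for the value at \<open>x\<close>\<close>
  define sol where "sol x = (SOME p. \<exists>Y. x < Y \<and> central Y (fst p) (snd p))" for x
  define s where "s x = fst (sol x) x" for x
  define g where "g x = snd (sol x) x" for x
  have agree: "s x = t x \<and> g x = k x" if c: "central Y t k" and x: "0 \<le> x" "x < Y" for Y t k x
  proof -
    have "\<exists>p. \<exists>Y. x < Y \<and> central Y (fst p) (snd p)" using c x by (intro exI[of _ "(t, k)"]) auto
    from someI_ex[OF this] obtain Y' where "x < Y'" "central Y' (fst (sol x)) (snd (sol x))"
      by (auto simp: sol_def)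
    then show ?thesis unfolding s_def g_def using central_unique c x by blast
  qed
  obtain Y t k where Y: "central Y t k" using A by (auto simp: A_def)
  then have Y0: "0 < Y" "Y \<le> X" using XA by (auto simp: central_def)
  have c: "central X s g"
    unfolding central_def flow_def
  proof (intro conjI allI impI)
    show "0 < X" using Y0 by auto
    show "s 0 = s\<^sub>0" "g 0 = 1" using agree[OF Y, of 0] Y by (auto simp: central_def)
    have "\<forall>\<^sub>F x in at_right 0. t x = s x" "\<forall>\<^sub>F x in at_right 0. k x = g x"
      using eventually_at_right_real[OF Y0(1)] by (eventually_elim, use agree[OF Y] in auto)+
    then show "(s \<longlongrightarrow> s\<^sub>0) (at_right 0)" "(g \<longlongrightarrow> 1) (at_right 0)"
      using Y by (auto simp: central_def intro: Lim_transform_eventually)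
    fix x assume x: "0 < x \<and> x < X"
    obtain Z t' k' where Z: "x < Z" "central Z t' k'" using reach x by blast
    then have fl: "flow Z t' k'" by (simp add: central_def)
    have xZ: "0 < x" "x < Z" using x Z by auto
    have e: "s x = t' x" "g x = k' x" using agree[OF Z(2)] xZ by auto
    note f = flowD[OF fl xZ]
    show "0 < g x" using f e by simp
    show "(g has_real_derivative x * s x) (at x)" unfolding e
      by (rule has_field_derivative_transform_within_open[OF f(2), of "{0<..<Z}"])
        (use xZ agree[OF Z(2)] in auto)
    show "(s has_real_derivative real N * (s\<^sub>0 - s x) / x - x * (Q (s x) / ((a + 1) * g x))) (at x)" unfolding e
      by (rule has_field_derivative_transform_within_open[OF f(3), of "{0<..<Z}"])
        (use xZ agree[OF Z(2)] in auto)
  qed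
  have X0: "0 < X" and fl: "flow X s g" using c by (auto simp: central_def)
  have low: "\<exists>x. 0 \<le> x \<and> x < X \<and> g x < \<epsilon>" if \<epsilon>: "0 < \<epsilon>" "\<epsilon> \<le> 1" for \<epsilon>
  proof (rule ccontr)
    assume "\<not> ?thesis"
    then have ge: "\<epsilon> \<le> g x" if "0 \<le> x" "x < X" for x using that by (auto simp: not_less)
    obtain u h where uh: "continuous_on {0..X+1} h" "h 0 = 1"
      "\<And>Y. 0 < Y \<Longrightarrow> Y \<le> X+1 \<Longrightarrow> (\<And>x. 0 \<le> x \<Longrightarrow> x < Y \<Longrightarrow> \<epsilon>/2 < h x) \<Longrightarrow> central Y u h"
      using central_while_above[of "\<epsilon>/2" "X+1", OF half_gt_zero[OF \<epsilon>(1)] add_pos_pos[OF X0 zero_less_one]] by metis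
    show False
    proof (cases "\<forall>x\<in>{0..X+1}. h x > \<epsilon>/2")
      case True
      then have "central (X+1) u h" using X0 by (intro uh(3)) auto
      then show False using XA by fastforce
    next
      case False
      then obtain x where x: "x \<in> {0..X+1}" "h x \<le> \<epsilon>/2" by (auto simp: not_less)
      have h0: "\<epsilon>/2 < h 0" using uh \<epsilon> by simp
      obtain y where y: "0 < y" "y \<le> x" "h y = \<epsilon>/2" "\<And>t. 0 \<le> t \<Longrightarrow> t < y \<Longrightarrow> h t > \<epsilon>/2"
        using first_crossing[OF uh(1) h0 x] by metis
      have cy: "central y u h" using y x by (intro uh(3)) auto
      then have yX: "y \<le> X" by (rule XA)
      have "h y \<ge> \<epsilon>"
      proof (rule tendsto_lowerbound)
        have "continuous_on {0..y} h" using uh(1) y x by (auto intro: continuous_on_subset)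
        then have "(h \<longlongrightarrow> h y) (at y within {0..y})" using y by (auto simp: continuous_on_def)
        then show "(h \<longlongrightarrow> h y) (at_left y)" by (simp add: at_within_Icc_at_left[OF y(1)])
        have "\<forall>\<^sub>F x in at_left y. x \<in> {0<..<y}" using y by (intro eventually_at_left_real)
        then show "\<forall>\<^sub>F x in at_left y. \<epsilon> \<le> h x"
        proof eventually_elim
            case (elim x)
            then show ?case using agree[OF cy, of x] ge[of x] yX by auto
          qed
      qed simp
      then show False using y \<epsilon> by simp
    qed
  qed
  have "(g \<longlongrightarrow> 0) (at_left X)"
  proof (rule tendstoI)
    fix e :: real assume e: "e > 0"
    define \<eta> where "\<eta> = min (X / 2) (e / (2 * (s\<^sub>0 * X)))"
    have \<eta>: "\<eta> > 0" "\<eta> < X" "\<eta> \<le> e / (2 * (s\<^sub>0 * X))" using e X0 s0_pos by (auto simp: \<eta>_def)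
    then have \<eta>': "s\<^sub>0 * X * \<eta> \<le> e / 2" using X0 s0_pos by (simp add: field_simps)
    have "continuous_on {0..X - \<eta>} g" using central_continuous(2)[OF c] \<eta> by auto
    then obtain d where d: "d > 0" "\<And>x. x \<in> {0..X - \<eta>} \<Longrightarrow> d \<le> g x"
      using continuous_pos_bounded_below[of 0 "X - \<eta>" g] central_pos[OF c] \<eta> by auto
    obtain x where x: "0 \<le> x" "x < X" "g x < min 1 (min d (e / 2))"
      using low[of "min 1 (min d (e / 2))"] d e by auto
    have xl: "X - \<eta> < x" using d(2)[of x] x by force
    have "\<forall>\<^sub>F y in at_left X. y \<in> {x<..<X}" using x by (intro eventually_at_left_real)
    then show "\<forall>\<^sub>F y in at_left X. dist (g y) 0 < e"
    proof eventually_elim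
      case (elim y)
      have x0: "0 < x" using xl \<eta> by simp
      have "g y - s\<^sub>0 * X * y \<le> g x - s\<^sub>0 * X * x"
      proof (rule nonincreasing_between[of 0 x y X])
        fix t assume t: "0 < t" "t < X"
        have "((\<lambda>y. g y - s\<^sub>0 * X * y) has_real_derivative t * s t - s\<^sub>0 * X) (at t)"
          using flowD(2)[OF fl t] by (auto intro!: derivative_eq_intros)
        moreover have "t * s t \<le> t * s\<^sub>0" using central_slope_le[OF c, of t] t by (intro mult_left_mono) auto
        moreover have "t * s\<^sub>0 \<le> X * s\<^sub>0" using t s0_pos by (intro mult_right_mono) auto
        ultimately show "\<exists>D\<le>0. ((\<lambda>y. g y - s\<^sub>0 * X * y) has_real_derivative D) (at t)"
          by (intro exI[of _ "t * s t - s\<^sub>0 * X"]) (auto simp: mult.commute)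
      qed (use elim x0 in auto)
      then have "g y \<le> g x + s\<^sub>0 * X * (y - x)" by (simp add: algebra_simps)
      also have "\<dots> \<le> g x + s\<^sub>0 * X * \<eta>"
        using elim xl X0 s0_pos by (intro add_left_mono mult_left_mono) auto
      also have "\<dots> < e" using \<eta>' x by simp
      finally show ?case using flowD(1)[OF fl, of y] elim x0 by (simp add: dist_real_def)
    qed
  qed
  with c show ?thesis using that by blast
qed

text \<open>
  For \<open>l > r\<close> the slope must fall below \<open>l\<close> somewhere near the interface, because \<open>Q\<close> is bounded away
  from \<open>0\<close> on \<open>[l, s\<^sub>0]\<close>. Close to the interface it cannot return to \<open>l\<close>: at \<open>s = l\<close> the forcing, which
  is of order \<open>1/g\<close>, makes the slope decrease.
\<close>

lemma central_slope_limit: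
  assumes c: "central X s g" and g0: "(g \<longlongrightarrow> 0) (at_left X)"
  shows "(s \<longlongrightarrow> r) (at_left X)"
proof (rule order_tendstoI)
  have X0: "0 < X" and fl: "flow X s g" using c by (auto simp: central_def)
  have inX: "\<forall>\<^sub>F x in at_left X. x \<in> {X/2<..<X}" using X0 by (intro eventually_at_left_real) auto
  show "\<forall>\<^sub>F x in at_left X. l < s x" if "l < r" for l
    using inX
  proof eventually_elim
    case (elim x)
    then show ?case using central_slope_gt[OF c, of x] that X0 by auto
  qed
  show "\<forall>\<^sub>F x in at_left X. s x < l" if l: "r < l" for l
  proof -
    obtain q where q: "q > 0" "\<And>v. v \<in> {l..s\<^sub>0} \<Longrightarrow> q \<le> Q v"
      using continuous_pos_bounded_below[of l s\<^sub>0 Q] Q_pos l Q_cont[of "{l..s\<^sub>0}" "\<lambda>x. x"] by auto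
    define G where "G = q * X\<^sup>2 / (4 * (a + 1) * (real N * (s\<^sub>0 - r)))"
    have G: "G > 0" using q X0 a N r_less_s0 by (simp add: G_def)
    have "\<forall>\<^sub>F x in at_left X. g x < G" using g0 G by (intro order_tendstoD)
    with inX have "\<forall>\<^sub>F x in at_left X. x \<in> {X/2<..<X} \<and> g x < G" by eventually_elim auto
    then obtain b where b: "b < X" "\<And>y. b < y \<Longrightarrow> y < X \<Longrightarrow> y \<in> {X/2<..<X} \<and> g y < G"
      using eventually_at_left[of 0 X] X0 by auto
    have "\<exists>x1>b. x1 < X \<and> s x1 < l"
    proof (rule ccontr)
      assume "\<not> ?thesis"
      then have no: "l \<le> s x" if "b < x" "x < X" for x using that by (metis not_less)
      have "\<forall>\<^sub>F x in at_left X. x \<in> {b<..<X}" using b(1) by (intro eventually_at_left_real)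
      with inX have "\<forall>\<^sub>F x in at_left X. - (-r) \<le> s x \<and> q \<le> Q (s x)"
      proof eventually_elim
        case (elim x)
        then have "0 \<le> x" "x < X" using X0 by auto
        then show ?case using central_slope_gt[OF c, of x] central_slope_le[OF c, of x] no[of x] elim q(2)[of "s x"] by auto
      qed
      from interface_slope_critical[OF X0 fl g0 q(1) this] show False .
    qed
    then obtain x1 where x1: "b < x1" "x1 < X" "s x1 < l" by blast
    have "\<forall>\<^sub>F x in at_left X. x \<in> {x1<..<X}" using x1 by (intro eventually_at_left_real)
    then show ?thesis
    proof eventually_elim
      case (elim x)
      have x10: "X/2 < x1" using b(2) x1 by auto
      have "- s x > - l"
      proof (rule barrier[of x1 x "\<lambda>x. - s x"])
        have "continuous_on {x1..x} s" using central_continuous(1)[OF c, of x] elim x10 X0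
          by (auto intro: continuous_on_subset)
        then show "continuous_on {x1..x} (\<lambda>x. - s x)" by (intro continuous_intros)
        fix y assume y: "x1 < y" "y \<le> x" "- s y = - l"
        have y': "0 < y" "y < X" "X/2 < y" "g y < G" using y x1 b(2)[of y] elim X0 by auto
        note f = flowD[OF fl y'(1,2)]
        have "s y \<in> {l..s\<^sub>0}" using y central_slope_le[OF c, of y] y' by auto
        then have Qq: "q \<le> Q (s y)" by (rule q)
        define n where "n = real N * (s\<^sub>0 - r)"
        define w where "w = (a + 1) * n"
        have w: "w > 0" using N r_less_s0 a by (simp add: n_def w_def)
        have "real N * (s\<^sub>0 - s y) / y < n / y" unfolding n_def
          using y y' l N by (intro divide_strict_right_mono mult_strict_left_mono) auto
        also have "\<dots> \<le> y * (q / ((a + 1) * g y))"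
        proof -
          have "X * X \<le> (2 * y) * (2 * y)" using y' X0 by (intro mult_mono) auto
          then have "q * X\<^sup>2 \<le> q * (4 * y\<^sup>2)" using q by (intro mult_left_mono) (auto simp: power2_eq_square)
          moreover have "G = q * X\<^sup>2 / (4 * w)" by (simp only: G_def w_def n_def mult.assoc)
          then have "G * (4 * w) = q * X\<^sup>2" using w by simp
          moreover have "g y * (4 * w) \<le> G * (4 * w)" using y' w by (intro mult_right_mono) auto
          ultimately have "g y * w \<le> q * y\<^sup>2" by simp
          then have "n * ((a + 1) * g y) \<le> q * y\<^sup>2" by (simp add: w_def mult_ac)
          moreover define A where "A = (a + 1) * g y"
          moreover have "A > 0" using f(1) a by (simp add: A_def)
          ultimately have "n * A \<le> q * y\<^sup>2" "A > 0" by simp_all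
          then show ?thesis unfolding A_def[symmetric] using y'
            by (simp add: field_simps power2_eq_square)
        qed
        also have "\<dots> \<le> y * (Q (s y) / ((a + 1) * g y))"
          using Qq y' f(1) a by (intro mult_left_mono divide_right_mono) auto
        finally show "\<exists>D>0. ((\<lambda>x. - s x) has_real_derivative D) (at y)"
          using DERIV_minus[OF f(3)] by (intro exI conjI) auto
      qed (use x1 elim in auto)
      then show ?case by simp
    qed
  qed
qed

end

section \<open>From profiles to the first order system\<close>

lemma small_derivative_at_right:
  fixes F :: "real \<Rightarrow> real"
  assumes F: "(F has_real_derivative 0) (at_right c)" and b: "c < b" and e: "e > 0"
    and D: "\<And>x. c < x \<Longrightarrow> x < b \<Longrightarrow> (F has_real_derivative F' x) (at x)"
  obtains z where "c < z" "z < b" "\<bar>F' z\<bar> < e"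
proof -
  have "((\<lambda>y. (F y - F c) / (y - c)) \<longlongrightarrow> 0) (at_right c)"
    using F by (simp add: has_field_derivative_iff)
  then have "\<forall>\<^sub>F y in at_right c. \<bar>(F y - F c) / (y - c)\<bar> < e"
    using e tendstoD by (fastforce simp: dist_real_def)
  with eventually_at_right_real[OF b]
  have "\<forall>\<^sub>F y in at_right c. y \<in> {c<..<b} \<and> \<bar>(F y - F c) / (y - c)\<bar> < e"
    by eventually_elim auto
  from eventually_happens'[OF trivial_limit_at_right_real this]
  obtain y where "y \<in> {c<..<b} \<and> \<bar>(F y - F c) / (y - c)\<bar> < e" by blast
  then have y: "c < y" "y < b" "\<bar>(F y - F c) / (y - c)\<bar> < e" by auto
  have "continuous_on {c..y} F"
    unfolding continuous_on_eq_continuous_within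
  proof
    fix t assume t: "t \<in> {c..y}"
    show "continuous (at t within {c..y}) F"
    proof (cases "t = c")
      case True
      then show ?thesis using DERIV_continuous[OF F] at_within_Icc_at_right[OF y(1)] by simp
    next
      case False
      then show ?thesis using DERIV_isCont[OF D[of t]] t y continuous_at_imp_continuous_within by auto
    qed
  qed
  then obtain l z where z: "c < z" "z < y" "DERIV F z :> l" "F y - F c = (y - c) * l"
    using MVT[OF y(1), of F] D y by (metis (no_types, opaque_lifting) less_trans real_differentiable_def)
  have "F' z = l" using DERIV_unique[OF D z(3)] z y by auto
  moreover have "(F y - F c) / (y - c) = l" using z y by simp
  ultimately show ?thesis using that[of z] z y by auto
qed

lemma small_derivative_at_left:
  fixes F :: "real \<Rightarrow> real"
  assumes F: "(F has_real_derivative 0) (at_left c)" and b: "b < c" and e: "e > 0"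
    and D: "\<And>x. b < x \<Longrightarrow> x < c \<Longrightarrow> (F has_real_derivative F' x) (at x)"
  obtains z where "b < z" "z < c" "\<bar>F' z\<bar> < e"
proof -
  have "((\<lambda>y. F (- y)) has_real_derivative 0) (at_right (- c))"
  proof -
    have "(F has_real_derivative 0) (at (- (- c)) within uminus ` {- c<..})"
      using F by (simp add: image_uminus_greaterThan)
    moreover have "(uminus has_real_derivative - 1) (at_right (- c))"
      by (auto intro!: derivative_eq_intros)
    ultimately have "(F \<circ> uminus has_real_derivative 0 * - 1) (at_right (- c))"
      by (rule DERIV_image_chain)
    then show ?thesis by (simp add: o_def)
  qed
  moreover have "((\<lambda>y. F (- y)) has_real_derivative - F' (- x)) (at x)" if "- c < x" "x < - b" for x
  proof -
    have "(uminus has_real_derivative - 1) (at x)" by (auto intro!: derivative_eq_intros)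
    from DERIV_chain'[OF this D[of "- x"]] that show ?thesis by simp
  qed
  ultimately obtain z where "- c < z" "z < - b" "\<bar>- F' (- z)\<bar> < e"
    using small_derivative_at_right[of "\<lambda>y. F (- y)" "- c" "- b" e "\<lambda>x. - F' (- x)"] b e by auto
  then show ?thesis using that[of "- z"] by auto
qed

context profile_flow begin

text \<open>
  The parameters are \<open>m = 1 + 1/a\<close>, \<open>p = 2 - m\<close> and \<open>\<sigma> = 2\<close>.
\<close>

abbreviation profile :: "(real \<Rightarrow> real) \<Rightarrow> real \<Rightarrow> bool" where
  "profile \<equiv> good_profile_with_interface N (1 + 1 / a) (1 - 1 / a) 2 \<alpha>"

definition height :: "(real \<Rightarrow> real) \<Rightarrow> real \<Rightarrow> real" where
  "height f x = f x powr (1 / a)"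

definition flux :: "(real \<Rightarrow> real) \<Rightarrow> real \<Rightarrow> real" where
  "flux f = deriv (\<lambda>x. f x powr (1 + 1 / a))"

definition slope :: "(real \<Rightarrow> real) \<Rightarrow> real \<Rightarrow> real" where
  "slope f x = flux f x / ((a + 1) * x * f x)"

text \<open>
  The quantity whose derivative in \<open>x\<close> is free of \<open>f'\<close> once the profile equation is multiplied by
  \<open>x\<^sup>N\<^sup>-\<^sup>1\<close>: the diffusive flux plus the transport term \<open>\<beta> x f\<close>, both weighted by \<open>x\<^sup>N\<^sup>-\<^sup>1\<close>.
\<close>

definition momentum :: "(real \<Rightarrow> real) \<Rightarrow> real \<Rightarrow> real" where
  "momentum f x = x ^ (N - 1) * flux f x + \<alpha> / (2 * a) * x ^ N * f x"

lemma profile_local: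
  assumes "profile f X" and x: "0 < x" "x < X"
  shows "f x > 0" "height f x > 0"
    and "((\<lambda>x. f x powr (1 + 1 / a)) has_real_derivative flux f x) (at x)"
    and "flux f x = (a + 1) * x * f x * slope f x"
    and "(f has_real_derivative a * x * f x * slope f x / height f x) (at x)"
    and "(flux f has_real_derivative - (real N - 1) / x * flux f x + \<alpha> * f x
      - \<alpha> / 2 * x\<^sup>2 * f x * slope f x / height f x - x\<^sup>2 * f x / height f x) (at x)"
proof -
  let ?F = "\<lambda>x. f x powr (1 + 1 / a)"
  have *: "f x > 0" "f differentiable at x" "?F differentiable at x"
    "deriv ?F differentiable at x"
    "deriv (deriv ?F) x + (real N - 1) / x * deriv ?F x - \<alpha> * f x
      + (1 + 1 / a - 1) / 2 * \<alpha> * x * deriv f x + x powr 2 * f x powr (1 - 1 / a) = 0"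
    using assms by (auto simp: good_profile_with_interface_def solves_profile_eq_def)
  show f: "f x > 0" by fact
  then show h: "height f x > 0" by (simp add: height_def)
  show F: "(?F has_real_derivative flux f x) (at x)"
    using *(3) DERIV_deriv_iff_real_differentiable by (simp add: flux_def)
  show fl: "flux f x = (a + 1) * x * f x * slope f x"
    using f x a by (simp add: slope_def)
  have df: "(f has_real_derivative deriv f x) (at x)"
    using *(2) DERIV_deriv_iff_real_differentiable by simp
  have "(?F has_real_derivative (1 + 1 / a) * height f x * deriv f x) (at x)"
    using DERIV_fun_powr[OF df f, of "1 + 1 / a"] by (simp add: height_def)
  from DERIV_unique[OF this F]
  have "(a + 1) * (height f x * deriv f x) = (a + 1) * (a * x * f x * slope f x)"
    using a unfolding fl by (simp add: field_simps)
  then have "height f x * deriv f x = a * x * f x * slope f x" using a by simp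
  then have f': "deriv f x = a * x * f x * slope f x / height f x"
    using a h by (simp add: field_simps)
  show "(f has_real_derivative a * x * f x * slope f x / height f x) (at x)"
    using df unfolding f' .
  have dF: "(flux f has_real_derivative deriv (deriv ?F) x) (at x)"
    unfolding flux_def using *(4) DERIV_deriv_iff_real_differentiable by blast
  have fp: "f x powr (1 - 1 / a) = f x / height f x"
    using f by (simp add: powr_diff height_def)
  have xp: "x powr 2 = x\<^sup>2" using x powr_realpow[of x 2] by simp
  have "deriv (deriv ?F) x = - (real N - 1) / x * flux f x + \<alpha> * f x
      - \<alpha> / 2 * x\<^sup>2 * f x * slope f x / height f x - x\<^sup>2 * f x / height f x"
  proof -
    have "(1 + 1 / a - 1) / 2 * \<alpha> * x * deriv f x = \<alpha> / 2 * x\<^sup>2 * f x * slope f x / height f x"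
      unfolding f' using a by (simp add: power2_eq_square)
    moreover have "- (real N - 1) / x * flux f x = - ((real N - 1) / x * flux f x)"
      by (simp only: minus_divide_left[symmetric] mult_minus_left)
    ultimately show ?thesis using *(5) unfolding fp xp flux_def[symmetric] times_divide_eq_right by linarith
  qed
  with dF show "(flux f has_real_derivative - (real N - 1) / x * flux f x + \<alpha> * f x
      - \<alpha> / 2 * x\<^sup>2 * f x * slope f x / height f x - x\<^sup>2 * f x / height f x) (at x)" by simp
qed

text \<open>
  Dividing the profile equation by \<open>(a+1) x f\<close> and using \<open>(f\<^sup>m)' = (a+1) x f s\<close>, \<open>f' = a x f s / g\<close> leaves an
  equation in \<open>s\<close> and \<open>g\<close> alone, since \<open>f\<^sup>p = f / g\<close>.
\<close>

lemma profile_is_flow: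
  assumes "profile f X"
  shows "flow X (slope f) (height f)"
  unfolding flow_def
proof (intro allI impI conjI)
  fix x assume x: "0 < x \<and> x < X"
  note p = profile_local[OF assms conjunct1[OF x] conjunct2[OF x]]
  show "height f x > 0" by fact
  have "f x powr (1 / a - 1) = height f x / f x"
    using p(1) by (simp add: powr_diff height_def)
  then show "(height f has_real_derivative x * slope f x) (at x)"
    unfolding height_def[abs_def] using DERIV_fun_powr[OF p(5,1), of "1 / a"] p(1,2) a
    by (simp add: height_def)
  define S where "S = slope f x"
  define G where "G = height f x"
  define y where "y = f x"
  have pos: "x > 0" "y > 0" "G > 0" "a > 0" "a + 1 > 0" using x p(1,2) a by (auto simp: y_def G_def)
  have y: "flux f x = (a + 1) * x * y * S" using p(4) by (simp add: y_def S_def)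
  let ?F'' = "- (real N - 1) / x * flux f x + \<alpha> * y - \<alpha> / 2 * x\<^sup>2 * y * S / G - x\<^sup>2 * y / G"
  have df: "(f has_real_derivative a * x * y * S / G) (at x)"
    using p(5) by (simp add: y_def S_def G_def)
  have "((\<lambda>x. (a + 1) * x * f x) has_real_derivative (a + 1) * (y + x * (a * x * y * S / G))) (at x)"
    by (rule derivative_eq_intros df refl)+ (simp add: y_def algebra_simps)
  moreover have "(flux f has_real_derivative ?F'') (at x)"
    using p(6) by (simp only: y_def S_def G_def)
  ultimately have "((\<lambda>x. flux f x / ((a + 1) * x * f x)) has_real_derivative
      (?F'' * ((a + 1) * x * f x) - flux f x * ((a + 1) * (y + x * (a * x * y * S / G)))) /
      ((a + 1) * x * f x * ((a + 1) * x * f x))) (at x)"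
    using pos by (intro DERIV_divide) (auto simp: y_def)
  moreover have "slope f = (\<lambda>x. flux f x / ((a + 1) * x * f x))"
    by (simp add: slope_def fun_eq_iff)
  ultimately have "(slope f has_real_derivative
      (?F'' * ((a + 1) * x * y) - flux f x * ((a + 1) * (y + x * (a * x * y * S / G)))) /
      ((a + 1) * x * y)\<^sup>2) (at x)"
    by (simp only: y_def[symmetric] power2_eq_square)
  moreover have "(?F'' * ((a + 1) * x * y) - flux f x * ((a + 1) * (y + x * (a * x * y * S / G)))) /
      ((a + 1) * x * y)\<^sup>2 = real N * (s\<^sub>0 - S) / x - x * (Q S / ((a + 1) * G))"
  proof -
    have Ns: "real N * s\<^sub>0 = \<alpha> / (a + 1)" using N by (simp add: s\<^sub>0_def)
    define w where "w = (a + 1) * x * y"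
    have w: "w \<noteq> 0" using pos by (simp add: w_def)
    define v where "v = 1 / x + a * x * S / G"
    have v: "(a + 1) * (y + x * (a * x * y * S / G)) = w * v"
      using pos by (simp add: w_def v_def field_simps)
    have "(W * w - w * S * (w * v)) / w\<^sup>2 = W / w - S * v" for W
      using w by (simp add: power2_eq_square field_simps)
    moreover have "S * v = S / x + a * x * S\<^sup>2 / G"
      by (simp add: v_def distrib_left power2_eq_square mult_ac)
    ultimately have 1: "(W * w - flux f x * ((a + 1) * (y + x * (a * x * y * S / G)))) / w\<^sup>2
        = W / w - S / x - a * x * S\<^sup>2 / G" for W
      unfolding y v unfolding w_def[symmetric] by simp
    have "- (real N - 1) / x * (w * S) / w = - (real N - 1) * S / x" using w by simp
    moreover have "\<alpha> * y / w = \<alpha> / ((a + 1) * x)" using pos by (simp add: w_def)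
    moreover have "\<alpha> / 2 * x\<^sup>2 * y * S / G / w = \<alpha> / 2 * x * S / ((a + 1) * G)"
      using pos by (simp add: w_def power2_eq_square mult_ac)
    moreover have "x\<^sup>2 * y / G / w = x / ((a + 1) * G)" using pos by (simp add: w_def power2_eq_square)
    ultimately have 2: "?F'' / w = - (real N - 1) * S / x + \<alpha> / ((a + 1) * x)
        - \<alpha> / 2 * x * S / ((a + 1) * G) - x / ((a + 1) * G)"
      unfolding y w_def[symmetric] by (simp only: diff_divide_distrib add_divide_distrib)
    have 3: "a * x * S\<^sup>2 / G = x * (a * (a + 1) * S\<^sup>2) / ((a + 1) * G)"
      using pos mult_divide_mult_cancel_left[of "a + 1" "a * x * S\<^sup>2" G] by (simp add: mult_ac)
    have "real N * (s\<^sub>0 - S) / x = \<alpha> / ((a + 1) * x) - real N * S / x"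
      by (simp add: right_diff_distrib Ns diff_divide_distrib)
    then show ?thesis unfolding w_def[symmetric] 1 2 3 Q_def
      by (simp add: diff_divide_distrib add_divide_distrib algebra_simps)
  qed
  ultimately show "(slope f has_real_derivative
      real N * (s\<^sub>0 - slope f x) / x - x * (Q (slope f x) / ((a + 1) * height f x))) (at x)"
    by (simp add: S_def G_def)
qed

lemma momentum_derivative:
  assumes "profile f X" and x: "0 < x" "x < X"
  shows "(momentum f has_real_derivative
    x ^ (N - 1) * ((\<alpha> + real N * \<alpha> / (2 * a)) * f x - x\<^sup>2 * f x / height f x)) (at x)"
proof -
  note p = profile_local[OF assms]
  define F' where "F' = flux f x"
  define F'' where "F'' = - (real N - 1) / x * F' + \<alpha> * f x
      - \<alpha> / 2 * x\<^sup>2 * f x * slope f x / height f x - x\<^sup>2 * f x / height f x"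
  define f' where "f' = a * x * f x * slope f x / height f x"
  have d: "(f has_real_derivative f') (at x)" "(flux f has_real_derivative F'') (at x)"
    using p(5,6) by (simp_all add: f'_def F''_def F'_def)
  obtain n where n: "N = Suc n" using N by (cases N) auto
  have mf: "momentum f = (\<lambda>x. x ^ n * flux f x + \<alpha> / (2 * a) * x ^ N * f x)"
    unfolding momentum_def[abs_def] by (simp add: n)
  have pow: "real n * x ^ (n - 1) = real n * x ^ n / x" using x by (cases n) auto
  have "(momentum f has_real_derivative
      real n * x ^ (n - 1) * F' + x ^ n * F'' + \<alpha> / (2 * a) * (real N * x ^ n * f x + x ^ N * f')) (at x)"
  proof -
    have "((\<lambda>x. x ^ N) has_real_derivative real N * x ^ n) (at x)"
      using DERIV_pow[of N x UNIV] by (simp add: n)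
    from DERIV_add[OF DERIV_mult[OF DERIV_pow d(2)] DERIV_mult[OF DERIV_cmult[OF this, of "\<alpha> / (2 * a)"] d(1)]]
    show ?thesis unfolding mf by (rule DERIV_cong) (simp add: F'_def algebra_simps)
  qed
  moreover have "real n * x ^ (n - 1) * F' + x ^ n * F'' + \<alpha> / (2 * a) * (real N * x ^ n * f x + x ^ N * f')
     = x ^ n * ((\<alpha> + real N * \<alpha> / (2 * a)) * f x - x\<^sup>2 * f x / height f x)"
  proof -
    have "x ^ N * f' = x ^ n * (a * x\<^sup>2 * f x * slope f x / height f x)"
      by (simp add: n f'_def power2_eq_square)
    then show ?thesis unfolding pow F''_def using a x n by (simp add: algebra_simps) (simp add: field_simps)
  qed
  ultimately show ?thesis using n by simp
qed

text \<open>
  Near the interface \<open>f / g = f\<^sup>2\<^sup>-\<^sup>m\<close> dominates \<open>f\<close>, so the momentum is decreasing there. Since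
  \<open>(f\<^sup>m)'\<close> vanishes at the interface, the momentum is arbitrarily small at points close to it, and hence
  nonnegative before it. This is the lower bound for the slope, because the momentum is
  \<open>x\<^sup>N f ((a+1) s + \<beta>)\<close>, where \<open>\<beta> = \<alpha>/(2a)\<close>.
\<close>

lemma profile_interface:
  assumes pr: "profile f X"
  shows "(height f \<longlongrightarrow> 0) (at_left X)"
    and "\<forall>\<^sub>F x in at_left X. - (\<alpha> / (2 * a * (a + 1))) \<le> slope f x"
proof -
  let ?F = "\<lambda>x. f x powr (1 + 1 / a)"
  have X: "X > 0" and fX: "f X = 0" and dF: "(?F has_real_derivative 0) (at_left X)"
    using pr by (auto simp: good_profile_with_interface_def)
  have inX: "\<forall>\<^sub>F x in at_left X. x \<in> {0<..<X}" using X by (intro eventually_at_left_real)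
  have "(?F \<longlongrightarrow> 0) (at_left X)"
    using DERIV_continuous[OF dF] fX by (simp add: continuous_within)
  then have "((\<lambda>x. ?F x powr (1 / (1 + 1 / a))) \<longlongrightarrow> 0) (at_left X)"
    by (rule tendsto_zero_powrI[OF _ tendsto_const]) (use a in \<open>auto intro!: add_pos_pos\<close>)
  moreover have "\<forall>\<^sub>F x in at_left X. ?F x powr (1 / (1 + 1 / a)) = f x"
    using inX
  proof eventually_elim
    case (elim x)
    then have "f x > 0" using profile_local(1)[OF pr] by auto
    moreover have "1 + 1 / a > 0" using a by (intro add_pos_pos) auto
    then have "(1 + 1 / a) * (1 / (1 + 1 / a)) = 1" by simp
    ultimately show ?case by (simp only: powr_powr) simp
  qed
  ultimately have f0: "(f \<longlongrightarrow> 0) (at_left X)" by (rule Lim_transform_eventually)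
  show h0: "(height f \<longlongrightarrow> 0) (at_left X)"
    unfolding height_def[abs_def]
  proof (rule tendsto_zero_powrI[OF f0 tendsto_const])
    show "\<forall>\<^sub>F x in at_left X. 0 \<le> f x"
      using inX by eventually_elim (use profile_local(1)[OF pr] in \<open>auto intro: less_imp_le\<close>)
  qed (use a in auto)
  define c where "c = \<alpha> + real N * \<alpha> / (2 * a)"
  have c: "c > 0" using \<alpha> a by (simp add: c_def add_pos_nonneg)
  have "\<forall>\<^sub>F x in at_left X. height f x < (X / 2)\<^sup>2 / c"
    using h0 X c by (intro order_tendstoD) auto
  moreover have "\<forall>\<^sub>F x in at_left X. x \<in> {X/2<..<X}" using X by (intro eventually_at_left_real) auto
  ultimately have "\<forall>\<^sub>F x in at_left X. x \<in> {X/2<..<X} \<and> height f x < (X / 2)\<^sup>2 / c"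
    by eventually_elim auto
  then obtain b where b: "b < X" "\<And>y. b < y \<Longrightarrow> y < X \<Longrightarrow> y \<in> {X/2<..<X} \<and> height f y < (X / 2)\<^sup>2 / c"
    using eventually_at_left[of 0 X] X by auto
  have dec: "\<exists>D\<le>0. (momentum f has_real_derivative D) (at x)" if x: "b < x" "x < X" for x
  proof -
    have x0: "0 < x" and xX: "X / 2 < x" "height f x < (X / 2)\<^sup>2 / c" using b(2)[OF x] X by auto
    note p = profile_local[OF pr x0 x(2)]
    have "c * height f x \<le> (X / 2)\<^sup>2" using xX c by (simp add: field_simps)
    also have "\<dots> \<le> x\<^sup>2" using xX X by (intro power_mono) auto
    finally have "c \<le> x\<^sup>2 / height f x" using p(2) by (simp add: field_simps)
    then have "f x * c \<le> f x * (x\<^sup>2 / height f x)" using p(1) by (intro mult_left_mono) auto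
    then have "x ^ (N - 1) * (c * f x - x\<^sup>2 * f x / height f x) \<le> 0"
      using x0 by (intro mult_nonneg_nonpos) (auto simp: mult_ac)
    then show ?thesis using momentum_derivative[OF pr x0 x(2)] unfolding c_def by blast
  qed
  have mom: "momentum f x \<ge> 0" if x: "b < x" "x < X" for x
  proof (rule ccontr)
    assume neg: "\<not> ?thesis"
    define e where "e = - momentum f x / X ^ (N - 1)"
    have e: "e > 0" using neg X by (simp add: e_def divide_neg_pos)
    have x0: "x > 0" using b(2)[OF x] X by auto
    obtain z where z: "x < z" "z < X" "\<bar>flux f z\<bar> < e"
      using small_derivative_at_left[OF dF x(2) e, of "flux f"] profile_local(3)[OF pr] x0 by auto
    have z0: "z > 0" using z x0 by simp
    have "momentum f z \<le> momentum f x"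
      by (rule nonincreasing_between[of b x z X]) (use x z dec in auto)
    moreover have "momentum f z > momentum f x"
    proof -
      have "\<alpha> / (2 * a) * z ^ N * f z \<ge> 0" using \<alpha> a z0 profile_local(1)[OF pr z0 z(2)] by simp
      moreover have "\<bar>z ^ (N - 1) * flux f z\<bar> < X ^ (N - 1) * e"
      proof -
        have "z ^ (N - 1) \<le> X ^ (N - 1)" using z z0 by (intro power_mono) auto
        then have "z ^ (N - 1) * \<bar>flux f z\<bar> \<le> X ^ (N - 1) * \<bar>flux f z\<bar>" by (intro mult_right_mono) auto
        also have "\<dots> < X ^ (N - 1) * e" using z X by (intro mult_strict_left_mono) auto
        finally show ?thesis using z0 by (simp add: abs_mult)
      qed
      moreover have "X ^ (N - 1) * e = - momentum f x" using X by (simp add: e_def)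
      ultimately show ?thesis unfolding momentum_def[of f z] by linarith
    qed
    ultimately show False by simp
  qed
  have "\<forall>\<^sub>F x in at_left X. x \<in> {b<..<X}" using b(1) by (intro eventually_at_left_real)
  then show "\<forall>\<^sub>F x in at_left X. - (\<alpha> / (2 * a * (a + 1))) \<le> slope f x"
  proof eventually_elim
    case (elim x)
    then have x: "b < x" "x < X" "0 < x" using b(2)[of x] X by auto
    note p = profile_local[OF pr x(3,2)]
    have xN: "x ^ N = x ^ (N - 1) * x" using N by (cases N) auto
    have "0 \<le> x ^ (N - 1) * (flux f x + \<alpha> / (2 * a) * x * f x)"
      using mom[OF x(1,2)] unfolding momentum_def xN by (simp add: algebra_simps)
    then have "0 \<le> flux f x + \<alpha> / (2 * a) * x * f x" 
      using zero_less_power[OF x(3), of "N - 1"] by (auto simp: zero_le_mult_iff)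
    also have "\<dots> = (x * f x) * ((a + 1) * slope f x + \<alpha> / (2 * a))"
      unfolding p(4) by (simp add: algebra_simps)
    finally have "0 \<le> (x * f x) * ((a + 1) * slope f x + \<alpha> / (2 * a))" .
    moreover have "0 < x * f x" using x p(1) by simp
    ultimately have "0 \<le> (a + 1) * slope f x + \<alpha> / (2 * a)"
      by (meson mult_pos_neg not_le)
    then have "- slope f x * (a + 1) \<le> \<alpha> / (2 * a)" by (simp add: mult.commute)
    then have "- slope f x \<le> \<alpha> / (2 * a) / (a + 1)" using a by (subst pos_le_divide_eq) auto
    then show ?case by simp
  qed
qed

text \<open>
  The discriminant of \<open>Q\<close> is negative, so \<open>Q\<close> is bounded below by some \<open>q > 0\<close>. The slope would then be
  unbounded below at the interface, against the sign of the momentum.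
\<close>

theorem no_profile_below_threshold:
  assumes "\<alpha> < 4 * sqrt (a * (a + 1))"
  shows "\<not> profile f X"
proof
  assume pr: "profile f X"
  define k where "k = a * (a + 1)"
  define q where "q = 1 - \<alpha>\<^sup>2 / (16 * k)"
  have k: "k > 0" using a by (simp add: k_def)
  have "\<alpha>\<^sup>2 < (4 * sqrt k)\<^sup>2" using assms \<alpha> unfolding k_def by (intro power_strict_mono) auto
  then have q: "q > 0" using k by (simp add: q_def power_mult_distrib)
  have "Q s \<ge> q" for s
  proof -
    have "Q s = k * (s + \<alpha> / (4 * k))\<^sup>2 + q"
      using k unfolding Q_def k_def[symmetric] q_def by (simp add: field_simps power2_eq_square)
    then show ?thesis using k by simp
  qed
  with profile_interface(2)[OF pr]
  have "\<forall>\<^sub>F x in at_left X. - (\<alpha> / (2 * a * (a + 1))) \<le> slope f x \<and> q \<le> Q (slope f x)" by simp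
  moreover have "X > 0" using pr by (simp add: good_profile_with_interface_def)
  ultimately show False
    using interface_slope_critical[OF _ profile_is_flow[OF pr] profile_interface(1)[OF pr] q] by blast
qed

end

context profile_flow begin

section \<open>Profiles at the centre\<close>

lemma flow_cong:
  assumes "flow X s g" "\<And>x. 0 < x \<Longrightarrow> x < X \<Longrightarrow> s' x = s x \<and> g' x = g x"
  shows "flow X s' g'"
  unfolding flow_def
proof (intro allI impI conjI)
  fix x assume x: "0 < x \<and> x < X"
  note f = flowD[OF assms(1) conjunct1[OF x] conjunct2[OF x]]
  have e: "s' x = s x" "g' x = g x" using assms(2) x by auto
  show "g' x > 0" using f e by simp
  show "(g' has_real_derivative x * s' x) (at x)" unfolding e
    by (rule has_field_derivative_transform_within_open[OF f(2), of "{0<..<X}"]) (use x assms(2) in auto)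
  show "(s' has_real_derivative real N * (s\<^sub>0 - s' x) / x - x * (Q (s' x) / ((a + 1) * g' x))) (at x)"
    unfolding e
    by (rule has_field_derivative_transform_within_open[OF f(3), of "{0<..<X}"]) (use x assms(2) in auto)
qed

text \<open>
  The momentum has derivative \<open>x\<^sup>N\<^sup>-\<^sup>1 (c + o(1))\<close> where
  \<open>c = \<alpha> + N \<alpha>/(2a)\<close>, so it remains to see that it
  vanishes at the centre. This is where \<open>f'(0) = 0\<close> enters: by the mean value theorem
  \<open>(f\<^sup>m)'\<close> is small at points arbitrarily close to \<open>0\<close>, and comparison with multiples of \<open>x\<^sup>N\<close> extends
  this to all nearby points.
\<close>

lemma profile_momentum_at_centre:
  assumes pr: "profile f X" and f0: "f 0 = 1"
  shows "((\<lambda>x. momentum f x / x ^ N) \<longlongrightarrow> (\<alpha> + real N * \<alpha> / (2 * a)) / real N) (at_right 0)"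
proof -
  let ?F = "\<lambda>x. f x powr (1 + 1 / a)"
  define c where "c = \<alpha> + real N * \<alpha> / (2 * a)"
  have X: "X > 0" and df: "(f has_real_derivative 0) (at_right 0)"
    using pr by (auto simp: good_profile_with_interface_def)
  have flim: "(f \<longlongrightarrow> 1) (at_right 0)"
    using DERIV_continuous[OF df] f0 by (simp add: continuous_within)
  have hlim: "(height f \<longlongrightarrow> 1) (at_right 0)"
    unfolding height_def[abs_def] using tendsto_powr[OF flim tendsto_const, of "1 / a"] by simp
  have dF: "(?F has_real_derivative 0) (at_right 0)"
  proof -
    have "((\<lambda>y. y powr (1 + 1 / a)) has_real_derivative (1 + 1 / a) * f 0 powr (1 / a)) (at (f 0))"
      using has_real_derivative_powr[of "f 0" "1 + 1 / a"] f0 by simp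
    from DERIV_chain'[OF df this] show ?thesis by simp
  qed
  have small: "\<exists>z. 0 < z \<and> z < d \<and> \<bar>momentum f z\<bar> < e" if de: "d > 0" "e > 0" for d e
  proof -
    have "((\<lambda>x. x ^ (N - 1) * (e / 2) + \<alpha> / (2 * a) * x ^ N * f x) \<longlongrightarrow> 0 ^ (N - 1) * (e / 2)) (at_right 0)"
      using N a by (auto intro!: tendsto_eq_intros flim)
    moreover have "(0::real) ^ (N - 1) \<le> 1" by (cases "N - 1") auto
    then have "0 ^ (N - 1) * (e / 2) \<le> 1 * (e / 2)" using de by (intro mult_right_mono) auto
    then have "0 ^ (N - 1) * (e / 2) < e" using de by simp
    ultimately have "\<forall>\<^sub>F x in at_right 0. x ^ (N - 1) * (e / 2) + \<alpha> / (2 * a) * x ^ N * f x < e"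
      by (rule order_tendstoD)
    then obtain b where b: "b > 0" "\<And>y. 0 < y \<Longrightarrow> y < b \<Longrightarrow> y ^ (N - 1) * (e / 2) + \<alpha> / (2 * a) * y ^ N * f y < e"
      using eventually_at_right[of 0 X] X by auto
    have "min b (min d X) > 0" using b de X by simp
    then obtain z where z: "0 < z" "z < min b (min d X)" "\<bar>flux f z\<bar> < e / 2"
      using small_derivative_at_right[OF dF, of "min b (min d X)" "e / 2" "flux f"] de
        profile_local(3)[OF pr] by auto
    have "\<bar>momentum f z\<bar> \<le> z ^ (N - 1) * \<bar>flux f z\<bar> + \<alpha> / (2 * a) * z ^ N * f z"
    proof -
      have "f z > 0" using profile_local(1)[OF pr, of z] z by auto
      then have "\<bar>\<alpha> / (2 * a) * z ^ N * f z\<bar> = \<alpha> / (2 * a) * z ^ N * f z" using z \<alpha> a by simp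
      moreover have "\<bar>z ^ (N - 1) * flux f z\<bar> = z ^ (N - 1) * \<bar>flux f z\<bar>" using z by (simp add: abs_mult)
      ultimately show ?thesis unfolding momentum_def
        by (metis abs_triangle_ineq)
    qed
    also have "\<dots> \<le> z ^ (N - 1) * (e / 2) + \<alpha> / (2 * a) * z ^ N * f z"
      using z by (intro add_right_mono mult_left_mono) auto
    also have "\<dots> < e" using b z by auto
    finally show ?thesis using z by auto
  qed
  have Npow: "((\<lambda>y. l / real N * y ^ N) has_real_derivative l * x ^ (N - 1)) (at x)" for l x :: real
    using N by (auto intro!: derivative_eq_intros)
  have clim: "((\<lambda>x. c * f x - x\<^sup>2 * f x / height f x) \<longlongrightarrow> c) (at_right 0)"
    by (auto intro!: tendsto_eq_intros flim hlim)
  note dm = momentum_derivative[OF pr, folded c_def]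
  have cmp: "K x \<le> 0" if K: "\<And>z. K z = \<tau> * (momentum f z - l / real N * z ^ N)" "\<bar>\<tau>\<bar> = 1"
    and dec: "\<And>t. 0 < t \<Longrightarrow> t < b \<Longrightarrow> \<exists>D\<le>0. (K has_real_derivative D) (at t)"
    and x: "0 < x" "x < b" for K \<tau> l b x
  proof (rule field_le_epsilon)
    fix e :: real assume e: "e > 0"
    have "((\<lambda>y. l / real N * y ^ N) \<longlongrightarrow> 0) (at_right 0)" using N by (auto intro!: tendsto_eq_intros)
    then have "\<forall>\<^sub>F y in at_right 0. \<bar>l / real N * y ^ N\<bar> < e / 2"
      using e tendstoD[of _ 0 "at_right 0" "e/2"] by (fastforce simp: dist_real_def)
    then obtain d where d: "d > 0" "\<And>y. 0 < y \<Longrightarrow> y < d \<Longrightarrow> \<bar>l / real N * y ^ N\<bar> < e / 2"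
      using eventually_at_right[of 0 X] X by auto
    obtain z where z: "0 < z" "z < min d x" "\<bar>momentum f z\<bar> < e / 2"
      using small[of "min d x" "e / 2"] d x e by auto
    have "K x \<le> K z" by (rule nonincreasing_between[of 0 z x b]) (use z x dec in auto)
    also have "K z \<le> \<bar>momentum f z - l / real N * z ^ N\<bar>"
      using K(2) abs_ge_self[of "K z"] by (simp add: K(1) abs_mult)
    also have "\<dots> < e"
    proof -
      have "\<bar>l / real N * z ^ N\<bar> < e / 2" using z d(2)[of z] by simp
      moreover have "\<bar>u\<bar> < e / 2 \<Longrightarrow> \<bar>v\<bar> < e / 2 \<Longrightarrow> \<bar>u - v\<bar> < e" for u v :: real by linarith
      ultimately show ?thesis using z(3) by blast
    qed
    finally show "K x \<le> 0 + e" by simp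
  qed
  show ?thesis
    unfolding c_def[symmetric]
  proof (rule order_tendstoI)
    fix q assume q: "q < c / real N"
    have "\<forall>\<^sub>F x in at_right 0. (real N * q + c) / 2 < c * f x - x\<^sup>2 * f x / height f x"
      using clim q N by (intro order_tendstoD(1)[OF clim]) (simp add: field_simps)
    then obtain b' where b': "b' > 0" "\<And>y. 0 < y \<Longrightarrow> y < b' \<Longrightarrow>
        (real N * q + c) / 2 < c * f y - y\<^sup>2 * f y / height f y"
      using eventually_at_right[of 0 X] X by auto
    define b where "b = min b' X"
    define l where "l = (real N * q + c) / 2"
    have b: "b > 0" using b' X by (simp add: b_def)
    have low: "- 1 * (momentum f x - l / real N * x ^ N) \<le> 0" if x: "0 < x" "x < b" for x
    proof (rule cmp[where K = "\<lambda>z. - 1 * (momentum f z - l / real N * z ^ N)" and \<tau> = "-1" and l = l and b = b and x = x])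
      fix t assume t: "0 < t" "t < b"
      have tX: "t < X" using t by (simp add: b_def)
      define D where "D = t ^ (N - 1) * (c * f t - t\<^sup>2 * f t / height f t)"
      have "l < c * f t - t\<^sup>2 * f t / height f t" using b' t by (simp add: l_def b_def)
      then have "t ^ (N - 1) * l \<le> D" unfolding D_def using t by (intro mult_left_mono) auto
      moreover have "((\<lambda>z. - 1 * (momentum f z - l / real N * z ^ N)) has_real_derivative
          - 1 * (D - l * t ^ (N - 1))) (at t)"
        unfolding D_def by (intro DERIV_cmult DERIV_diff dm[OF t(1) tX] Npow)
      ultimately show "\<exists>D\<le>0. ((\<lambda>z. - 1 * (momentum f z - l / real N * z ^ N)) has_real_derivative D) (at t)"
        by (intro exI conjI) (auto simp: mult.commute)
    qed (use x in auto)
    from eventually_at_right_real[OF b] show "\<forall>\<^sub>F x in at_right 0. q < momentum f x / x ^ N"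
    proof eventually_elim
      case (elim x)
      have "q < l / real N" using q N by (simp add: l_def field_simps)
      also have "\<dots> \<le> momentum f x / x ^ N" using low[of x] elim by (simp add: pos_le_divide_eq)
      finally show ?case .
    qed
  next
    fix q assume q: "c / real N < q"
    have "\<forall>\<^sub>F x in at_right 0. c * f x - x\<^sup>2 * f x / height f x < (real N * q + c) / 2"
      using clim q N by (intro order_tendstoD(2)[OF clim]) (simp add: field_simps)
    then obtain b' where b': "b' > 0" "\<And>y. 0 < y \<Longrightarrow> y < b' \<Longrightarrow>
        c * f y - y\<^sup>2 * f y / height f y < (real N * q + c) / 2"
      using eventually_at_right[of 0 X] X by auto
    define b where "b = min b' X"
    define l where "l = (real N * q + c) / 2"
    have b: "b > 0" using b' X by (simp add: b_def)
    have up: "1 * (momentum f x - l / real N * x ^ N) \<le> 0" if x: "0 < x" "x < b" for x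
    proof (rule cmp[where K = "\<lambda>z. 1 * (momentum f z - l / real N * z ^ N)" and \<tau> = 1 and l = l and b = b and x = x])
      fix t assume t: "0 < t" "t < b"
      have tX: "t < X" using t by (simp add: b_def)
      define D where "D = t ^ (N - 1) * (c * f t - t\<^sup>2 * f t / height f t)"
      have "c * f t - t\<^sup>2 * f t / height f t < l" using b' t by (simp add: l_def b_def)
      then have "D \<le> t ^ (N - 1) * l" unfolding D_def using t by (intro mult_left_mono) auto
      moreover have "((\<lambda>z. 1 * (momentum f z - l / real N * z ^ N)) has_real_derivative
          1 * (D - l * t ^ (N - 1))) (at t)"
        unfolding D_def by (intro DERIV_cmult DERIV_diff dm[OF t(1) tX] Npow)
      ultimately show "\<exists>D\<le>0. ((\<lambda>z. 1 * (momentum f z - l / real N * z ^ N)) has_real_derivative D) (at t)"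
        by (intro exI conjI) (auto simp: mult.commute)
    qed (use x in auto)
    from eventually_at_right_real[OF b] show "\<forall>\<^sub>F x in at_right 0. momentum f x / x ^ N < q"
    proof eventually_elim
      case (elim x)
      have "momentum f x / x ^ N \<le> l / real N" using up[of x] elim by (simp add: pos_divide_le_eq)
      also have "\<dots> < q" using q N by (simp add: l_def field_simps)
      finally show ?case .
    qed
  qed
qed

lemma profile_is_central:
  assumes pr: "profile f X" and f0: "f 0 = 1"
  shows "central X (\<lambda>x. if x = 0 then s\<^sub>0 else slope f x) (height f)"
proof -
  have X: "X > 0" and df: "(f has_real_derivative 0) (at_right 0)"
    using pr by (auto simp: good_profile_with_interface_def)
  have flim: "(f \<longlongrightarrow> 1) (at_right 0)"
    using DERIV_continuous[OF df] f0 by (simp add: continuous_within)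
  have hlim: "(height f \<longlongrightarrow> 1) (at_right 0)"
    unfolding height_def[abs_def] using tendsto_powr[OF flim tendsto_const, of "1 / a"] by simp
  have "((\<lambda>x. (momentum f x / x ^ N - \<alpha> / (2 * a) * f x) / ((a + 1) * f x)) \<longlongrightarrow>
      ((\<alpha> + real N * \<alpha> / (2 * a)) / real N - \<alpha> / (2 * a) * 1) / ((a + 1) * 1)) (at_right 0)"
    using a by (intro tendsto_intros profile_momentum_at_centre[OF pr f0] flim) auto
  moreover have "((\<alpha> + real N * \<alpha> / (2 * a)) / real N - \<alpha> / (2 * a) * 1) / ((a + 1) * 1) = s\<^sub>0"
  proof -
    have "(\<alpha> + real N * \<alpha> / (2 * a)) / real N = \<alpha> / real N + \<alpha> / (2 * a)"
      using N by (simp add: add_divide_distrib)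
    then show ?thesis by (simp add: s\<^sub>0_def mult.commute)
  qed
  ultimately have lim: "((\<lambda>x. (momentum f x / x ^ N - \<alpha> / (2 * a) * f x) / ((a + 1) * f x)) \<longlongrightarrow> s\<^sub>0) (at_right 0)"
    by simp
  have "\<forall>\<^sub>F x in at_right 0. (momentum f x / x ^ N - \<alpha> / (2 * a) * f x) / ((a + 1) * f x)
      = (if x = 0 then s\<^sub>0 else slope f x)"
    using eventually_at_right_real[OF X]
  proof eventually_elim
    case (elim x)
    have xN: "x ^ N = x ^ (N - 1) * x" using N by (cases N) auto
    have "momentum f x / x ^ N = flux f x / x + \<alpha> / (2 * a) * f x"
      unfolding momentum_def xN using elim by (simp add: add_divide_distrib)
    then show ?case using elim by (simp add: slope_def mult_ac)
  qed
  from Lim_transform_eventually[OF lim this]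
  have "((\<lambda>x. if x = 0 then s\<^sub>0 else slope f x) \<longlongrightarrow> s\<^sub>0) (at_right 0)" .
  moreover have "flow X (\<lambda>x. if x = 0 then s\<^sub>0 else slope f x) (height f)"
    by (rule flow_cong[OF profile_is_flow[OF pr]]) auto
  ultimately show ?thesis using X hlim f0 by (simp add: central_def height_def)
qed

text \<open>
  A solution living beyond \<open>X\<close> would be positive at \<open>X\<close>, although it agrees before \<open>X\<close> with one that tends
  to \<open>0\<close> there.
\<close>

lemma central_extinction_unique:
  assumes 1: "central X s g" "(g \<longlongrightarrow> 0) (at_left X)" and 2: "central Y t h"
  shows "Y \<le> X"
proof (rule ccontr)
  assume "\<not> Y \<le> X"
  then have XY: "X < Y" by simp
  have X: "X > 0" using 1 by (simp add: central_def)
  have "isCont h X" using flowD(2)[of Y t h X] 2 X XY DERIV_isCont by (auto simp: central_def)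
  then have "(h \<longlongrightarrow> h X) (at_left X)" by (auto simp: isCont_def intro: tendsto_within_subset)
  moreover have "\<forall>\<^sub>F x in at_left X. h x = g x"
  proof -
    have "\<forall>\<^sub>F x in at_left X. x \<in> {0<..<X}" using X by (intro eventually_at_left_real)
    then show ?thesis
    proof eventually_elim
      case (elim x)
      then show ?case using central_unique(2)[OF 1(1) 2, of x] XY by auto
    qed
  qed
  ultimately have "(g \<longlongrightarrow> h X) (at_left X)" by (rule Lim_transform_eventually)
  from tendsto_unique[OF _ this 1(2)] have "h X = 0" by simp
  then show False using central_pos[OF 2, of X] X XY by simp
qed

section \<open>From the first order system to profiles\<close>

definition profile_of :: "real \<Rightarrow> (real \<Rightarrow> real) \<Rightarrow> real \<Rightarrow> real" where
  "profile_of X g x = (if 0 \<le> x \<and> x < X then g x powr a else 0)"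

lemma profile_of_powr:
  assumes "0 \<le> x" "x < X"
  shows "profile_of X g x powr b = g x powr (a * b)"
  using assms by (simp add: profile_of_def powr_powr)

lemma profile_of_solves:
  assumes fl: "flow X s g"
  shows "solves_profile_eq N (1 + 1 / a) (1 - 1 / a) 2 \<alpha> ((1 + 1 / a - 1) / 2 * \<alpha>) (profile_of X g) {0<..<X}"
  unfolding solves_profile_eq_def
proof
  fix x assume "x \<in> {0<..<X}"
  then have x: "0 < x" "x < X" by auto
  let ?f = "profile_of X g"
  let ?F = "\<lambda>x. ?f x powr (1 + 1 / a)"
  have f_eq: "?f y = g y powr a" if "0 < y" "y < X" for y using that by (simp add: profile_of_def)
  have F_eq: "?F y = g y powr (a + 1)" if "0 < y" "y < X" for y
  proof -
    have "a * (1 + 1 / a) = a + 1" using a by (simp add: field_simps)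
    then show ?thesis using profile_of_powr[of y X g "1 + 1 / a"] that by simp
  qed
  have df: "(?f has_real_derivative a * g y powr (a - 1) * (y * s y)) (at y)" if y: "0 < y" "y < X" for y
  proof (rule has_field_derivative_transform_within_open[of "\<lambda>y. g y powr a" _ _ "{0<..<X}"])
    show "((\<lambda>y. g y powr a) has_real_derivative a * g y powr (a - 1) * (y * s y)) (at y)"
      using DERIV_fun_powr[OF flowD(2,1)[OF fl y], of a] by simp
  qed (use y f_eq in auto)
  have dF: "(?F has_real_derivative (a + 1) * (y * s y * g y powr a)) (at y)" if y: "0 < y" "y < X" for y
  proof (rule has_field_derivative_transform_within_open[of "\<lambda>y. g y powr (a + 1)" _ _ "{0<..<X}"])
    show "((\<lambda>y. g y powr (a + 1)) has_real_derivative (a + 1) * (y * s y * g y powr a)) (at y)"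
      using DERIV_fun_powr[OF flowD(2,1)[OF fl y], of "a + 1"] by (simp add: mult_ac)
  qed (use y F_eq in auto)
  note fx = flowD[OF fl x]
  define G where "G = g x"
  define P where "P = g x powr a"
  define S where "S = s x"
  define S' where "S' = real N * (s\<^sub>0 - S) / x - x * (Q S / ((a + 1) * G))"
  define D where "D = (a + 1) * ((S + x * S') * P + x * S * (a * (P / G) * (x * S)))"
  have G: "G > 0" "P > 0" using fx(1) by (auto simp: G_def P_def)
  have PG: "g x powr (a - 1) = P / G" using fx(1) by (simp add: P_def G_def powr_diff)
  have d2: "(deriv ?F has_real_derivative D) (at x)"
  proof (rule has_field_derivative_transform_within_open[of "\<lambda>y. (a + 1) * (y * s y * g y powr a)" _ _ "{0<..<X}"])
    have gd: "((\<lambda>y. g y powr a) has_real_derivative a * (P / G) * (x * S)) (at x)"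
      using DERIV_fun_powr[OF fx(2,1), of a] by (simp add: PG S_def)
    have sd: "(s has_real_derivative S') (at x)" using fx(3) by (simp add: S'_def S_def G_def)
    show "((\<lambda>y. (a + 1) * (y * s y * g y powr a)) has_real_derivative D) (at x)"
      using DERIV_cmult[OF DERIV_mult[OF DERIV_mult[OF DERIV_ident sd] gd], of "a + 1"]
      by (simp add: D_def P_def S_def algebra_simps)
    show "(a + 1) * (y * s y * g y powr a) = deriv ?F y" if "y \<in> {0<..<X}" for y
      using DERIV_imp_deriv[OF dF[of y]] that by simp
  qed (use x in auto)
  have fp: "?f x powr (1 - 1 / a) = P / G"
  proof -
    have "a * (1 - 1 / a) = a - 1" using a by (simp add: field_simps)
    then show ?thesis using profile_of_powr[of x X g "1 - 1 / a"] x by (simp add: PG)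
  qed
  have xp: "x powr 2 = x\<^sup>2" using x powr_realpow[of x 2] by simp
  have "D + (real N - 1) / x * ((a + 1) * (x * S * P)) - \<alpha> * P
      + (1 + 1 / a - 1) / 2 * \<alpha> * x * (a * (P / G) * (x * S)) + x\<^sup>2 * (P / G) = 0"
  proof -
    have Ns: "(a + 1) * (real N * s\<^sub>0) = \<alpha>" using N a by (simp add: s\<^sub>0_def)
    have "x * (u / x - x * v) = u - x\<^sup>2 * v" for u v
      using x by (simp add: right_diff_distrib power2_eq_square)
    then have "x * S' = real N * (s\<^sub>0 - S) - x\<^sup>2 * (Q S / ((a + 1) * G))" by (simp only: S'_def)
    moreover have "(a + 1) * (x\<^sup>2 * (Q S / ((a + 1) * G))) = x\<^sup>2 * Q S / G" using a by simp
    ultimately have "(a + 1) * (x * S') = (a + 1) * (real N * s\<^sub>0) - (a + 1) * (real N * S) - x\<^sup>2 * Q S / G"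
      by (simp add: right_diff_distrib)
    then have 1: "(a + 1) * (x * S') = \<alpha> - (a + 1) * (real N * S) - x\<^sup>2 * Q S / G" unfolding Ns .
    have D1: "D = P * ((a + 1) * S + (a + 1) * (x * S') + (a + 1) * a * (x\<^sup>2 * S\<^sup>2 / G))"
      by (simp add: D_def power2_eq_square algebra_simps)
    have T1: "(real N - 1) / x * ((a + 1) * (x * S * P)) = P * ((real N - 1) * ((a + 1) * S))"
      using x by simp
    have T2: "(1 + 1 / a - 1) / 2 * \<alpha> * x * (a * (P / G) * (x * S)) = P * (\<alpha> / 2 * (x\<^sup>2 * S / G))"
      using a by (simp add: power2_eq_square)
    have QE: "x\<^sup>2 * Q S / G = a * (a + 1) * (x\<^sup>2 * S\<^sup>2 / G) + \<alpha> / 2 * (x\<^sup>2 * S / G) + x\<^sup>2 / G"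
      by (simp add: Q_def distrib_left add_divide_distrib mult_ac)
    have T3: "x\<^sup>2 * (P / G) = P * (x\<^sup>2 / G)" by simp
    show ?thesis unfolding D1 T1 T2 T3 1 QE by (simp add: algebra_simps)
  qed
  moreover have "deriv ?F x = (a + 1) * (x * S * P)" "deriv ?f x = a * (P / G) * (x * S)"
    "deriv (deriv ?F) x = D" "?f x = P"
    using DERIV_imp_deriv[OF dF[OF x]] DERIV_imp_deriv[OF df[OF x]] DERIV_imp_deriv[OF d2] f_eq[OF x]
    by (simp_all add: P_def S_def PG[unfolded P_def])
  ultimately show "?f differentiable at x \<and> ?F differentiable at x \<and> deriv ?F differentiable at x \<and>
      deriv (deriv ?F) x + (real N - 1) / x * deriv ?F x - \<alpha> * ?f x
      + (1 + 1 / a - 1) / 2 * \<alpha> * x * deriv ?f x + x powr 2 * ?f x powr (1 - 1 / a) = 0"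
    using df[OF x] dF[OF x] d2 unfolding fp xp by (auto simp: real_differentiable_def)
qed

end

context interface_flow begin

lemma central_linear_extinction:
  assumes c: "central X s g" and g0: "(g \<longlongrightarrow> 0) (at_left X)"
  shows "((\<lambda>x. g x / (X - x)) \<longlongrightarrow> - r * X) (at_left X)"
proof (rule lhopital_left[where f' = "\<lambda>x. x * s x" and g' = "\<lambda>_. - 1"])
  have X: "X > 0" and fl: "flow X s g" using c by (auto simp: central_def)
  have inX: "\<forall>\<^sub>F x in at_left X. x \<in> {0<..<X}" using X by (intro eventually_at_left_real)
  show "(g \<longlongrightarrow> 0) (at_left X)" by (rule g0)
  show "((\<lambda>x. X - x) \<longlongrightarrow> 0) (at_left X)" by (auto intro!: tendsto_eq_intros)
  show "\<forall>\<^sub>F x in at_left X. X - x \<noteq> 0" using inX by eventually_elim auto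
  show "\<forall>\<^sub>F x in at_left X. (g has_real_derivative x * s x) (at x)"
    using inX by eventually_elim (use flowD(2)[OF fl] in auto)
  show "\<forall>\<^sub>F x in at_left X. ((\<lambda>x. X - x) has_real_derivative - 1) (at x)"
    by (auto intro!: always_eventually derivative_eq_intros)
  show "((\<lambda>x. x * s x / - 1) \<longlongrightarrow> - r * X) (at_left X)"
    by (auto intro!: tendsto_eq_intros central_slope_limit[OF c g0])
qed simp

lemma profile_of_is_profile:
  assumes c: "central X s g" and g0: "(g \<longlongrightarrow> 0) (at_left X)"
  shows "profile (profile_of X g) X"
  unfolding good_profile_with_interface_def
proof (intro conjI ballI)
  have X: "X > 0" and fl: "flow X s g" and slim: "(s \<longlongrightarrow> s\<^sub>0) (at_right 0)" and glim: "(g \<longlongrightarrow> 1) (at_right 0)"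
    and g1: "g 0 = 1" using c by (auto simp: central_def)
  let ?f = "profile_of X g"
  show "0 < X" by (rule X)
  show "solves_profile_eq N (1 + 1 / a) (1 - 1 / a) 2 \<alpha> ((1 + 1 / a - 1) / 2 * \<alpha>) ?f {0<..<X}"
    by (rule profile_of_solves[OF fl])
  show "?f 0 > 0" using X g1 by (simp add: profile_of_def)
  show "?f X = 0" by (simp add: profile_of_def)
  show "?f x > 0" if "x \<in> {0<..<X}" for x
    using that flowD(1)[OF fl, of x] by (simp add: profile_of_def)
  have in0: "\<forall>\<^sub>F x in at_right 0. x \<in> {0<..<X}" using X by (intro eventually_at_right_real)
  have "((\<lambda>x. (g x powr a - 1) / x) \<longlongrightarrow> 0) (at_right 0)"
  proof (rule lhopital_right[where f' = "\<lambda>x. a * g x powr (a - 1) * (x * s x)" and g' = "\<lambda>_. 1"])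
    show "((\<lambda>x. g x powr a - 1) \<longlongrightarrow> 0) (at_right 0)"
      by (auto intro!: tendsto_eq_intros glim)
    show "((\<lambda>x. x) \<longlongrightarrow> 0) (at_right (0::real))" by (auto intro!: tendsto_eq_intros)
    show "\<forall>\<^sub>F x in at_right 0. x \<noteq> (0::real)" using in0 by eventually_elim auto
    show "\<forall>\<^sub>F x in at_right 0. ((\<lambda>x. g x powr a - 1) has_real_derivative a * g x powr (a - 1) * (x * s x)) (at x)"
      using in0
    proof eventually_elim
      case (elim x)
      then have "0 < x" "x < X" by auto
      from DERIV_diff[OF DERIV_fun_powr[OF flowD(2,1)[OF fl this], of a] DERIV_const[of 1]]
      show ?case by simp
    qed
    show "((\<lambda>x. a * g x powr (a - 1) * (x * s x) / 1) \<longlongrightarrow> 0) (at_right 0)"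
      by (auto intro!: tendsto_eq_intros glim slim)
  qed (auto intro!: derivative_eq_intros)
  moreover have "\<forall>\<^sub>F x in at_right 0. (g x powr a - 1) / x = (?f x - ?f 0) / (x - 0)"
    using in0 by eventually_elim (use g1 X in \<open>auto simp: profile_of_def\<close>)
  ultimately show "(?f has_real_derivative 0) (at_right 0)"
    unfolding has_field_derivative_iff by (rule Lim_transform_eventually)
  have inX: "\<forall>\<^sub>F x in at_left X. x \<in> {0<..<X}" using X by (intro eventually_at_left_real)
  have "((\<lambda>x. g x powr a) \<longlongrightarrow> 0) (at_left X)"
  proof (rule tendsto_zero_powrI[OF g0 tendsto_const])
    show "\<forall>\<^sub>F x in at_left X. 0 \<le> g x"
      using inX by eventually_elim (use flowD(1)[OF fl] in \<open>auto intro: less_imp_le\<close>)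
  qed (use a in auto)
  from tendsto_minus[OF tendsto_mult[OF central_linear_extinction[OF c g0] this]]
  have "((\<lambda>x. - (g x / (X - x) * g x powr a)) \<longlongrightarrow> 0) (at_left X)" by simp
  moreover have "\<forall>\<^sub>F x in at_left X. - (g x / (X - x) * g x powr a)
      = (?f x powr (1 + 1 / a) - ?f X powr (1 + 1 / a)) / (x - X)"
    using inX
  proof eventually_elim
    case (elim x)
    have "a * (1 + 1 / a) = 1 + a" using a by (simp add: field_simps)
    then have "?f x powr (1 + 1 / a) = g x * g x powr a"
      using profile_of_powr[of x X g "1 + 1 / a"] elim flowD(1)[OF fl, of x] by (simp add: powr_add)
    moreover have "?f X powr (1 + 1 / a) = 0" by (simp add: profile_of_def)
    moreover have "x - X = - (X - x)" by simp
    ultimately show ?case by (simp only: divide_minus_right) simp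
  qed
  ultimately show "((\<lambda>x. ?f x powr (1 + 1 / a)) has_real_derivative 0) (at_left X)"
    unfolding has_field_derivative_iff by (rule Lim_transform_eventually)
qed

lemma profile_of_interface:
  assumes c: "central X s g" and g0: "(g \<longlongrightarrow> 0) (at_left X)"
  shows "interface_behavior (1 + 1 / a) (profile_of X g) X"
proof -
  have X: "X > 0" and fl: "flow X s g" using c by (auto simp: central_def)
  have rX: "- r * X > 0" using r_neg X by (simp add: mult_neg_pos)
  define C where "C = (- r * X) powr a"
  have C: "C > 0" using r_neg X by (simp add: C_def)
  have inX: "\<forall>\<^sub>F x in at_left X. x \<in> {0<..<X}" using X by (intro eventually_at_left_real)
  have "((\<lambda>x. (g x / (X - x)) powr a / C) \<longlongrightarrow> C / C) (at_left X)"
    unfolding C_def using r_neg X by (intro tendsto_intros central_linear_extinction[OF c g0]) auto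
  then have "((\<lambda>x. (g x / (X - x)) powr a / C) \<longlongrightarrow> 1) (at_left X)" using C by simp
  moreover have "\<forall>\<^sub>F x in at_left X. (g x / (X - x)) powr a / C
      = profile_of X g x / (C * max 0 (X - x) powr (1 / (1 + 1 / a - 1)))"
    using inX
  proof eventually_elim
    case (elim x)
    then show ?case using flowD(1)[OF fl, of x]
      by (simp add: profile_of_def powr_divide max_def mult.commute)
  qed
  ultimately have "((\<lambda>x. profile_of X g x / (C * max 0 (X - x) powr (1 / (1 + 1 / a - 1)))) \<longlongrightarrow> 1) (at_left X)"
    by (rule Lim_transform_eventually)
  then show ?thesis unfolding interface_behavior_def using C by (intro exI[of _ C] conjI asymp_equivI')
qed

end

context profile_flow begin

section \<open>Existence, uniqueness and the threshold\<close>

text \<open>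
  The profile comes from the maximal central solution. Any other profile with \<open>f(0) = 1\<close> yields a central
  solution whose pressure also dies at its interface, and two such solutions have the same lifetime.
\<close>

theorem unique_profile_above_threshold:
  assumes "\<alpha> \<ge> 4 * sqrt (a * (a + 1))"
  shows "\<exists>f X. profile f X \<and> f 0 = 1 \<and> interface_behavior (1 + 1 / a) f X \<and>
    (\<forall>h Y. profile h Y \<and> h 0 = 1 \<longrightarrow> Y = X \<and> (\<forall>x\<in>{0..X}. h x = f x))"
proof -
  obtain r where "r < 0" "Q r = 0" "r + \<alpha> / (2 * (a + 1)) > 0" "\<And>s. s > r \<Longrightarrow> Q s > 0"
    using critical_slope_exists[OF assms] by metis
  then interpret interface_flow N a \<alpha> r by unfold_locales auto
  obtain X s g where c: "central X s g" and g0: "(g \<longlongrightarrow> 0) (at_left X)"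
    by (rule maximal_central)
  have "Y = X \<and> (\<forall>x\<in>{0..X}. h x = profile_of X g x)" if pr: "profile h Y" and h0: "h 0 = 1" for h Y
  proof -
    note ch = profile_is_central[OF pr h0]
    have "Y \<le> X" by (rule central_extinction_unique[OF c g0 ch])
    moreover have "X \<le> Y" by (rule central_extinction_unique[OF ch profile_interface(1)[OF pr] c])
    ultimately have XY: "Y = X" by simp
    have "h x = profile_of X g x" if x: "x \<in> {0..X}" for x
    proof (cases "x = X")
      case True
      then show ?thesis using pr XY by (simp add: profile_of_def good_profile_with_interface_def)
    next
      case False
      then have x': "0 \<le> x" "x < X" using x by auto
      have "h x > 0" using h0 profile_local(1)[OF pr, of x] x' XY by (cases "x = 0") auto
      then have "h x = height h x powr a" using a by (simp add: height_def powr_powr)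
      also have "height h x = g x" using central_unique(2)[OF c ch, of x] x' XY by simp
      finally show ?thesis using x' by (simp add: profile_of_def)
    qed
    with XY show ?thesis by blast
  qed
  moreover have "profile_of X g 0 = 1" using c by (simp add: profile_of_def central_def)
  ultimately show ?thesis
    using profile_of_is_profile[OF c g0] profile_of_interface[OF c g0] by blast
qed

end

theorem theorem1p3:
  fixes N :: nat and m p \<sigma> :: real
  assumes "N \<ge> 1" and "m > 1" and "0 < p" and "p < 1"
    and "\<sigma> = 2 * (1 - p) / (m - 1)" and "m + p = 2"
  shows "(\<forall>\<alpha>\<ge>alpha_star m.
            \<exists>f \<xi>\<^sub>0.
              good_profile_with_interface N m p \<sigma> \<alpha> f \<xi>\<^sub>0 \<and> f 0 = 1 \<and> interface_behavior m f \<xi>\<^sub>0 \<and>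
              (\<forall>g \<eta>\<^sub>0.
                 good_profile_with_interface N m p \<sigma> \<alpha> g \<eta>\<^sub>0 \<and> g 0 = 1 \<and> interface_behavior m g \<eta>\<^sub>0
                 \<longrightarrow> \<eta>\<^sub>0 = \<xi>\<^sub>0 \<and> (\<forall>\<xi>\<in>{0..\<xi>\<^sub>0}. g \<xi> = f \<xi>)))
       \<and> (\<forall>\<alpha>. 0 < \<alpha> \<and> \<alpha> < alpha_star m \<longrightarrow>
            \<not> (\<exists>f \<xi>\<^sub>0. good_profile_with_interface N m p \<sigma> \<alpha> f \<xi>\<^sub>0))"
proof -
  define a where "a = 1 / (m - 1)"
  have a: "a > 1" using assms by (simp add: a_def)
  have m: "m = 1 + 1 / a" by (simp add: a_def)
  have p: "p = 1 - 1 / a" using assms(6) m by simp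
  have \<sigma>: "\<sigma> = 2" using assms(5) a unfolding m p by simp
  have thr: "alpha_star m = 4 * sqrt (a * (a + 1))"
  proof -
    have "a * (a + 1) = m * a\<^sup>2" using a by (simp add: m field_simps power2_eq_square)
    then have "sqrt (a * (a + 1)) = sqrt m * a" using a by (simp add: real_sqrt_mult)
    then show ?thesis by (simp add: alpha_star_def a_def)
  qed
  have thr0: "alpha_star m > 0" using a by (simp add: thr)
  have flow: "profile_flow N a \<alpha>" if "\<alpha> > 0" for \<alpha>
    using assms(1) a that by unfold_locales
  show ?thesis
  proof (intro conjI allI impI)
    fix \<alpha> assume \<alpha>: "alpha_star m \<le> \<alpha>"
    have "\<alpha> > 0" "4 * sqrt (a * (a + 1)) \<le> \<alpha>"
      using less_le_trans[OF thr0 \<alpha>] \<alpha> by (simp_all add: thr)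
    from profile_flow.unique_profile_above_threshold[OF flow[OF this(1)] this(2)]
    obtain f X where "good_profile_with_interface N m p \<sigma> \<alpha> f X" "f 0 = 1" "interface_behavior m f X"
      "\<forall>h Y. good_profile_with_interface N m p \<sigma> \<alpha> h Y \<and> h 0 = 1 \<longrightarrow> Y = X \<and> (\<forall>x\<in>{0..X}. h x = f x)"
      unfolding m p \<sigma> by blast
    then show "\<exists>f \<xi>\<^sub>0. good_profile_with_interface N m p \<sigma> \<alpha> f \<xi>\<^sub>0 \<and> f 0 = 1 \<and> interface_behavior m f \<xi>\<^sub>0 \<and>
       (\<forall>g \<eta>\<^sub>0. good_profile_with_interface N m p \<sigma> \<alpha> g \<eta>\<^sub>0 \<and> g 0 = 1 \<and> interface_behavior m g \<eta>\<^sub>0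
          \<longrightarrow> \<eta>\<^sub>0 = \<xi>\<^sub>0 \<and> (\<forall>\<xi>\<in>{0..\<xi>\<^sub>0}. g \<xi> = f \<xi>))"
      by (intro exI[of _ f] exI[of _ X]) blast
  next
    fix \<alpha> assume "0 < \<alpha> \<and> \<alpha> < alpha_star m"
    then have "\<alpha> > 0" "\<alpha> < 4 * sqrt (a * (a + 1))" by (simp_all add: thr)
    from profile_flow.no_profile_below_threshold[OF flow[OF this(1)] this(2)]
    show "\<not> (\<exists>f \<xi>\<^sub>0. good_profile_with_interface N m p \<sigma> \<alpha> f \<xi>\<^sub>0)"
      unfolding m p \<sigma> by blast
  qed
qed

end
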